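(* Let $M$ be a $II_1$ factor (with separable predual) equipped with a faithful normal tracial state $\tau$. Let $a,b\in M$ with $a=a^*$, $b=b^*$ be such that $\mu_a$ and $\mu_b$ have no atoms. Then $$a\le b\ \Longrightarrow\ X_a\le X_b .$$
   Context: All von Neumann algebras are assumed to have separable predual. For a self-adjoint $c\in M$, the distribution of $c$ is the compactly supported Borel probability measure $\mu_c$ on $\mathbb{R}$ given by $\mu_c(E)=\tau(1_E(c))$. Its (left-continuous) distribution function is $F_c(t)=\mu_c((-\infty,t))$, $t\in\mathbb{R}$, and its quantile function is $X_c:[0,1)\to\mathbb{R}$, $X_c(s)=\inf\{t\in\mathbb{R}: F_c(t)>s\}$. The order $a\le b$ means that $b-a$ is a positive operator, and $X_a\le X_b$ means pointwise inequality on $[0,1)$. *)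

theory Defs
  imports "HOL-Analysis.Analysis" "HOL-Library.Nonpos_Ints"
begin

section \<open>Complex Hilbert spaces\<close>

text \<open>The real inner product underlying the class \<open>real_inner\<close> is the real part of
  \<open>cinner\<close>, so norm, topology and completeness are those of the complex inner product.
  The inner product is conjugate-linear in its first argument.\<close>

class chilbert_space = real_inner + complete_space +
  fixes scaleC :: "complex \<Rightarrow> 'a \<Rightarrow> 'a"  (infixr "*\<^sub>C" 75)
    and cinner :: "'a \<Rightarrow> 'a \<Rightarrow> complex"
  assumes scaleC_add_right: "c *\<^sub>C (x + y) = c *\<^sub>C x + c *\<^sub>C y"
    and scaleC_add_left: "(c + d) *\<^sub>C x = c *\<^sub>C x + d *\<^sub>C x"
    and scaleC_scaleC: "c *\<^sub>C (d *\<^sub>C x) = (c * d) *\<^sub>C x"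
    and scaleC_of_real: "complex_of_real r *\<^sub>C x = r *\<^sub>R x"
    and cinner_commute: "cinner x y = cnj (cinner y x)"
    and cinner_add_right: "cinner x (y + z) = cinner x y + cinner x z"
    and cinner_scaleC_right: "cinner x (c *\<^sub>C y) = c * cinner x y"
    and Re_cinner: "Re (cinner x y) = inner x y"

lemma cinner_scaleC_left: "cinner (c *\<^sub>C x) y = cnj c * cinner x y"
  for x y :: "'h::chilbert_space"
  by (metis cinner_commute cinner_scaleC_right complex_cnj_mult)

lemma cinner_self: "cinner x x = complex_of_real ((norm x)\<^sup>2)"
  for x :: "'h::chilbert_space"
proof (rule complex_eqI)
  show "Re (cinner x x) = Re (complex_of_real ((norm x)\<^sup>2))"
    by (simp add: Re_cinner power2_norm_eq_inner)
  have "cinner x x = cnj (cinner x x)" by (rule cinner_commute)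
  then have "Im (cinner x x) = - Im (cinner x x)" by (metis cnj.sel(2))
  then show "Im (cinner x x) = Im (complex_of_real ((norm x)\<^sup>2))" by simp
qed

lemma norm_scaleC: "norm (c *\<^sub>C x) = cmod c * norm x"
  for x :: "'h::chilbert_space"
proof -
  have "complex_of_real ((norm (c *\<^sub>C x))\<^sup>2) = cnj c * (c * cinner x x)"
    by (metis cinner_self cinner_scaleC_left cinner_scaleC_right mult.left_commute)
  also have "\<dots> = (c * cnj c) * complex_of_real ((norm x)\<^sup>2)"
    by (simp add: cinner_self)
  also have "\<dots> = complex_of_real ((cmod c * norm x)\<^sup>2)"
    by (simp add: power_mult_distrib flip: complex_norm_square)
  finally have "(norm (c *\<^sub>C x))\<^sup>2 = (cmod c * norm x)\<^sup>2"
    by (simp only: of_real_eq_iff)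
  then show ?thesis by (simp add: power2_eq_iff_nonneg)
qed

section \<open>Bounded operators\<close>

text \<open>\<open>'h \<Rightarrow>\<^sub>L 'h\<close> consists of the bounded real-linear maps; \<open>bounded_ops\<close> is \<open>B(H)\<close>.\<close>

definition bounded_ops :: "('h::chilbert_space \<Rightarrow>\<^sub>L 'h) set" where
  "bounded_ops = {x. \<forall>c \<xi>. blinfun_apply x (c *\<^sub>C \<xi>) = c *\<^sub>C blinfun_apply x \<xi>}"

lift_definition scaleC_op ::
  "complex \<Rightarrow> ('h::chilbert_space \<Rightarrow>\<^sub>L 'h) \<Rightarrow> ('h \<Rightarrow>\<^sub>L 'h)"
  is "\<lambda>c x \<xi>. c *\<^sub>C x \<xi>"
proof -
  fix c :: complex and x :: "'h \<Rightarrow> 'h"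
  assume "bounded_linear x"
  moreover have "bounded_linear (\<lambda>\<xi>::'h. c *\<^sub>C \<xi>)"
  proof (rule bounded_linear_intro)
    show "c *\<^sub>C (r *\<^sub>R \<xi>) = r *\<^sub>R (c *\<^sub>C \<xi>)" for r and \<xi> :: 'h
      by (metis mult.commute scaleC_of_real scaleC_scaleC)
    show "norm (c *\<^sub>C \<xi>) \<le> norm \<xi> * cmod c" for \<xi> :: 'h
      by (simp add: norm_scaleC mult.commute)
  qed (rule scaleC_add_right)
  ultimately show "bounded_linear (\<lambda>\<xi>. c *\<^sub>C x \<xi>)"
    by (rule bounded_linear_compose[rotated])
qed

definition adj :: "('h::chilbert_space \<Rightarrow>\<^sub>L 'h) \<Rightarrow> ('h \<Rightarrow>\<^sub>L 'h)" where
  "adj x = (THE y. \<forall>\<xi> \<eta>. cinner (blinfun_apply y \<xi>) \<eta> = cinner \<xi> (blinfun_apply x \<eta>))"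

definition positive_op :: "('h::chilbert_space \<Rightarrow>\<^sub>L 'h) \<Rightarrow> bool" where
  "positive_op x \<longleftrightarrow> x \<in> bounded_ops \<and> (\<forall>\<xi>. cinner \<xi> (blinfun_apply x \<xi>) \<in> \<real>\<^sub>\<ge>\<^sub>0)"

definition op_le :: "('h::chilbert_space \<Rightarrow>\<^sub>L 'h) \<Rightarrow> ('h \<Rightarrow>\<^sub>L 'h) \<Rightarrow> bool" where
  "op_le a b \<longleftrightarrow> positive_op (b - a)"

definition projection_op :: "('h::chilbert_space \<Rightarrow>\<^sub>L 'h) \<Rightarrow> bool" where
  "projection_op p \<longleftrightarrow> p \<in> bounded_ops \<and> p o\<^sub>L p = p \<and> adj p = p"

section \<open>Von Neumann algebras and II1 factors\<close>

definition commutant :: "('h::chilbert_space \<Rightarrow>\<^sub>L 'h) set \<Rightarrow> ('h \<Rightarrow>\<^sub>L 'h) set" where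
  "commutant S = {y \<in> bounded_ops. \<forall>x\<in>S. x o\<^sub>L y = y o\<^sub>L x}"

definition von_neumann_algebra :: "('h::chilbert_space \<Rightarrow>\<^sub>L 'h) set \<Rightarrow> bool" where
  "von_neumann_algebra M \<longleftrightarrow>
     M \<subseteq> bounded_ops \<and> (\<forall>x\<in>M. adj x \<in> M) \<and> commutant (commutant M) = M"

text \<open>Normal functionals are the ultraweakly continuous ones; they form the predual.\<close>

definition normal_functional ::
  "('h::chilbert_space \<Rightarrow>\<^sub>L 'h) set \<Rightarrow> (('h \<Rightarrow>\<^sub>L 'h) \<Rightarrow> complex) \<Rightarrow> bool" where
  "normal_functional M \<phi> \<longleftrightarrow>
     (\<exists>\<xi> \<eta> :: nat \<Rightarrow> 'h. summable (\<lambda>n. (norm (\<xi> n))\<^sup>2) \<and> summable (\<lambda>n. (norm (\<eta> n))\<^sup>2) \<and>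
        (\<forall>x\<in>M. (\<lambda>n. cinner (\<xi> n) (blinfun_apply x (\<eta> n))) sums \<phi> x))"

text \<open>Separability with respect to the norm of functionals on \<open>M\<close>.\<close>

definition separable_predual :: "('h::chilbert_space \<Rightarrow>\<^sub>L 'h) set \<Rightarrow> bool" where
  "separable_predual M \<longleftrightarrow>
     (\<exists>D. countable D \<and> (\<forall>\<psi>\<in>D. normal_functional M \<psi>) \<and>
        (\<forall>\<phi> \<epsilon>. normal_functional M \<phi> \<and> \<epsilon> > 0 \<longrightarrow>
           (\<exists>\<psi>\<in>D. \<forall>x\<in>M. norm x \<le> 1 \<longrightarrow> cmod (\<phi> x - \<psi> x) \<le> \<epsilon>)))"

definition vn_factor :: "('h::chilbert_space \<Rightarrow>\<^sub>L 'h) set \<Rightarrow> bool" where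
  "vn_factor M \<longleftrightarrow> von_neumann_algebra M \<and> (id_blinfun :: 'h \<Rightarrow>\<^sub>L 'h) \<noteq> 0 \<and>
     M \<inter> commutant M = range (\<lambda>c. scaleC_op c id_blinfun)"

text \<open>The unit is a finite projection: it is not Murray-von Neumann equivalent in \<open>M\<close> to a
  proper subprojection.\<close>

definition finite_vn :: "('h::chilbert_space \<Rightarrow>\<^sub>L 'h) set \<Rightarrow> bool" where
  "finite_vn M \<longleftrightarrow>
     (\<forall>v\<in>M. adj v o\<^sub>L v = id_blinfun \<longrightarrow> v o\<^sub>L adj v = id_blinfun)"

definition abelian_projection ::
  "('h::chilbert_space \<Rightarrow>\<^sub>L 'h) set \<Rightarrow> ('h \<Rightarrow>\<^sub>L 'h) \<Rightarrow> bool" where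
  "abelian_projection M p \<longleftrightarrow> p \<in> M \<and> projection_op p \<and>
     (\<forall>x\<in>M. \<forall>y\<in>M. (p o\<^sub>L x o\<^sub>L p) o\<^sub>L (p o\<^sub>L y o\<^sub>L p) = (p o\<^sub>L y o\<^sub>L p) o\<^sub>L (p o\<^sub>L x o\<^sub>L p))"

text \<open>A finite von Neumann algebra is of type II1 iff it has no nonzero abelian projection
  (semifiniteness being automatic).\<close>

definition II1_factor :: "('h::chilbert_space \<Rightarrow>\<^sub>L 'h) set \<Rightarrow> bool" where
  "II1_factor M \<longleftrightarrow> vn_factor M \<and> finite_vn M \<and> (\<forall>p. abelian_projection M p \<longrightarrow> p = 0)"

definition faithful_normal_tracial_state ::
  "('h::chilbert_space \<Rightarrow>\<^sub>L 'h) set \<Rightarrow> (('h \<Rightarrow>\<^sub>L 'h) \<Rightarrow> complex) \<Rightarrow> bool" where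
  "faithful_normal_tracial_state M \<tau> \<longleftrightarrow>
     (\<forall>x\<in>M. \<forall>y\<in>M. \<tau> (x + y) = \<tau> x + \<tau> y) \<and>
     (\<forall>c. \<forall>x\<in>M. \<tau> (scaleC_op c x) = c * \<tau> x) \<and>
     (\<forall>x\<in>M. positive_op x \<longrightarrow> \<tau> x \<in> \<real>\<^sub>\<ge>\<^sub>0) \<and>
     \<tau> id_blinfun = 1 \<and>
     (\<forall>x\<in>M. \<forall>y\<in>M. \<tau> (x o\<^sub>L y) = \<tau> (y o\<^sub>L x)) \<and>
     (\<forall>x\<in>M. positive_op x \<and> \<tau> x = 0 \<longrightarrow> x = 0) \<and>
     normal_functional M \<tau>"

section \<open>Spectral measure, distribution and quantile function\<close>

definition vector_measure :: "(real set \<Rightarrow> ('h::chilbert_space \<Rightarrow>\<^sub>L 'h)) \<Rightarrow> 'h \<Rightarrow> real measure" where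
  "vector_measure P \<xi> =
     measure_of UNIV (sets borel) (\<lambda>E. ennreal (Re (cinner \<xi> (blinfun_apply (P E) \<xi>))))"

text \<open>\<open>P\<close> is a compactly supported projection-valued Borel measure with \<open>c = \<integral> t dP(t)\<close>,
  the integral being understood weakly.\<close>

definition is_spectral_measure ::
  "('h::chilbert_space \<Rightarrow>\<^sub>L 'h) \<Rightarrow> (real set \<Rightarrow> ('h \<Rightarrow>\<^sub>L 'h)) \<Rightarrow> bool" where
  "is_spectral_measure c P \<longleftrightarrow>
     (\<forall>E\<in>sets borel. projection_op (P E)) \<and>
     P UNIV = id_blinfun \<and>
     (\<forall>E\<in>sets borel. \<forall>F\<in>sets borel. P (E \<inter> F) = P E o\<^sub>L P F) \<and>
     (\<forall>A :: nat \<Rightarrow> real set. range A \<subseteq> sets borel \<and> disjoint_family A \<longrightarrow>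
        (\<forall>\<xi>. (\<lambda>n. blinfun_apply (P (A n)) \<xi>) sums blinfun_apply (P (\<Union>n. A n)) \<xi>)) \<and>
     (\<exists>K. P {-K..K} = id_blinfun) \<and>
     (\<forall>\<xi>. cinner \<xi> (blinfun_apply c \<xi>) =
            complex_of_real (\<integral>t. t \<partial>vector_measure P \<xi>))"

text \<open>The spectral projection \<open>1\<^sub>E(c)\<close> of a self-adjoint \<open>c\<close>. By the spectral theorem the
  spectral measure exists and is unique on Borel sets, so the choice is immaterial there.\<close>

definition spectral_projection ::
  "('h::chilbert_space \<Rightarrow>\<^sub>L 'h) \<Rightarrow> real set \<Rightarrow> ('h \<Rightarrow>\<^sub>L 'h)" where
  "spectral_projection c = (SOME P. is_spectral_measure c P)"

definition op_distribution ::
  "(('h::chilbert_space \<Rightarrow>\<^sub>L 'h) \<Rightarrow> complex) \<Rightarrow> ('h \<Rightarrow>\<^sub>L 'h) \<Rightarrow> real measure" where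
  "op_distribution \<tau> c =
     measure_of UNIV (sets borel) (\<lambda>E. ennreal (Re (\<tau> (spectral_projection c E))))"

definition no_atoms :: "real measure \<Rightarrow> bool" where
  "no_atoms \<mu> \<longleftrightarrow> (\<forall>t. emeasure \<mu> {t} = 0)"

text \<open>Left-continuous, in contrast to the library's \<open>cdf\<close>.\<close>

definition dist_fun :: "(('h::chilbert_space \<Rightarrow>\<^sub>L 'h) \<Rightarrow> complex) \<Rightarrow> ('h \<Rightarrow>\<^sub>L 'h) \<Rightarrow> real \<Rightarrow> real" where
  "dist_fun \<tau> c t = measure (op_distribution \<tau> c) {..<t}"

definition quantile_fun :: "(('h::chilbert_space \<Rightarrow>\<^sub>L 'h) \<Rightarrow> complex) \<Rightarrow> ('h \<Rightarrow>\<^sub>L 'h) \<Rightarrow> real \<Rightarrow> real" where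
  "quantile_fun \<tau> c s = Inf {t. dist_fun \<tau> c t > s}"

end

theory Submission
  imports Defs "HOL-Probability.Distribution_Functions"
begin

text \<open>
  Let \<open>E\<^sub>c(t)\<close> be the spectral projection of \<open>c\<close> for \<open>(-\<infinity>, t)\<close>. A vector \<open>v\<close> in the range of
  \<open>E\<^sub>b(t)\<close> and orthogonal to the range of \<open>E\<^sub>a(t)\<close> satisfies
  \<open>t * \<bar>v\<bar>\<^sup>2 \<le> (v, a v) \<le> (v, b v)\<close>, while \<open>(v, b v) < t * \<bar>v\<bar>\<^sup>2\<close> unless \<open>v = 0\<close>. So
  \<open>p = E\<^sub>b(t)\<close> and \<open>1 - r\<close>, where \<open>r = E\<^sub>a(t)\<close>, have ranges meeting only in \<open>0\<close>, and this forces
  \<open>\<tau> p \<le> \<tau> r\<close> (\<open>trace_projection_le\<close>). Hence the distribution function of \<open>b\<close> lies below that of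
  \<open>a\<close>, and its quantile function above.

  The inequality \<open>\<tau> p \<le> \<tau> r\<close> is usually read off from the equivalence of \<open>p \<or> q - q\<close> and
  \<open>p - p \<and> q\<close>, with \<open>q = 1 - r\<close>. Here polar decomposition is replaced by von Neumann's alternating
  projections: the trace property gives
  \<open>\<tau> p - \<tau> ((p q p)\<^sup>n) = \<tau> r - \<tau> ((r (1 - p) r)\<^sup>n)\<close>, the last trace is nonnegative for even
  \<open>n\<close>, and \<open>(p q p)\<^sup>n\<close> tends strongly to the projection onto the common range of \<open>p\<close> and \<open>q\<close>, which
  is \<open>0\<close>; normality carries this limit over to the trace.

  The chosen spectral projections have the expected meaning only once a spectral measure is known
  to exist, and the trace can be applied to them only once they are known to lie in the algebra. Both
  come from one description of the spectral subspace of \<open>c\<close> for \<open>(-\<infinity>, s]\<close>: with \<open>T = c + \<bar>c\<bar>\<close>,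
  which is positive, it consists of the vectors \<open>v\<close> for which \<open>\<bar>T\<^sup>n v\<bar>\<close> grows at most like
  \<open>(s + \<bar>c\<bar>)\<^sup>n\<close>. This subspace is visibly invariant under all operators commuting with \<open>c\<close> and
  right-continuous in \<open>s\<close>. That \<open>c \<ge> s\<close> holds on its orthogonal complement uses the modulus of
  \<open>c - s\<close>, obtained as a norm limit of polynomials (\<open>modulus_exists\<close>). The projections onto these
  subspaces yield a Stieltjes measure for every vector, and a Dynkin-class argument turns these
  into a projection-valued measure (\<open>spectral_measure_exists\<close>). Conversely any spectral measure of
  \<open>c\<close> has exactly these subspaces as the ranges of its half-line projections
  (\<open>P_atMost_eq_resolution\<close>), so its values commute with the commutant of the algebra.

  Except where complex linearity is at stake, operators are treated as real-linear maps with the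
  real inner product.
\<close>

instance chilbert_space \<subseteq> banach ..

section \<open>Orthogonal projections and adjoints in Hilbert space\<close>

text \<open>By the parallelogram law a minimizing sequence is Cauchy, because midpoints stay in the
  subspace.\<close>
lemma closest_point_exists:
  fixes S :: "'a::{real_inner, banach} set"
  assumes "subspace S" "closed S"
  obtains y where "y \<in> S" "\<And>z. z \<in> S \<Longrightarrow> norm (x - y) \<le> norm (x - z)"
proof -
  define d where "d = (INF z\<in>S. norm (x - z))"
  have S0: "0 \<in> S" using assms by (simp add: subspace_0)
  have bdd: "bdd_below ((\<lambda>z. norm (x - z)) ` S)" by (rule bdd_belowI[of _ 0]) auto
  have d_le: "d \<le> norm (x - z)" if "z \<in> S" for z
    unfolding d_def by (rule cINF_lower[OF bdd that])
  have d0: "0 \<le> d" unfolding d_def using S0 by (intro cINF_greatest) auto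
  have "\<exists>z\<in>S. (norm (x - z))\<^sup>2 < d\<^sup>2 + 1 / real (Suc n)" for n
  proof -
    have "d < sqrt (d\<^sup>2 + 1 / real (Suc n))"
      using d0 by (intro real_less_rsqrt) auto
    then obtain z where "z \<in> S" "norm (x - z) < sqrt (d\<^sup>2 + 1 / real (Suc n))"
      using cINF_less_iff[OF _ bdd] S0 unfolding d_def by blast
    moreover have "0 \<le> d\<^sup>2 + 1 / real (Suc n)" by (auto intro!: add_nonneg_nonneg)
    ultimately have "(norm (x - z))\<^sup>2 < (sqrt (d\<^sup>2 + 1 / real (Suc n)))\<^sup>2"
      by (intro power_strict_mono) auto
    then show ?thesis using \<open>z \<in> S\<close> \<open>0 \<le> d\<^sup>2 + 1 / real (Suc n)\<close>
      by (intro bexI[of _ z]) (auto simp del: of_nat_Suc)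
  qed
  then obtain y where yS: "\<And>n. y n \<in> S"
    and y: "\<And>n. (norm (x - y n))\<^sup>2 < d\<^sup>2 + 1 / real (Suc n)" by metis
  have near: "(norm (y m - y n))\<^sup>2 \<le> 2 / real (Suc m) + 2 / real (Suc n)" for m n
  proof -
    have "(1/2) *\<^sub>R (y m + y n) \<in> S"
      using assms yS by (simp add: subspace_add subspace_scale)
    then have "d\<^sup>2 \<le> (norm (x - (1/2) *\<^sub>R (y m + y n)))\<^sup>2"
      using d_le d0 by (simp add: power_mono)
    moreover have "(norm (y m - y n))\<^sup>2 = 2 * (norm (x - y m))\<^sup>2 + 2 * (norm (x - y n))\<^sup>2
        - 4 * (norm (x - (1/2) *\<^sub>R (y m + y n)))\<^sup>2"
      by (simp add: power2_norm_eq_inner inner_simps inner_commute algebra_simps)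
    ultimately show ?thesis using y[of m] y[of n] by simp
  qed
  have "Cauchy y"
  proof (rule metric_CauchyI)
    fix e :: real assume "0 < e"
    obtain N where N: "inverse (real (Suc N)) < e\<^sup>2 / 4"
      using reals_Archimedean[of "e\<^sup>2 / 4"] \<open>0 < e\<close> by auto
    show "\<exists>N. \<forall>m\<ge>N. \<forall>n\<ge>N. dist (y m) (y n) < e"
    proof (intro exI[of _ N] allI impI)
      fix m n assume "N \<le> m" "N \<le> n"
      then have "1 / real (Suc m) \<le> inverse (real (Suc N))" "1 / real (Suc n) \<le> inverse (real (Suc N))"
        by (auto simp: field_simps)
      then have "2 / real (Suc m) + 2 / real (Suc n) < e\<^sup>2" using N by simp
      then have "(norm (y m - y n))\<^sup>2 < e\<^sup>2" using near[of m n] by linarith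
      then show "dist (y m) (y n) < e"
        using \<open>0 < e\<close> by (simp add: dist_norm power2_less_imp_less)
    qed
  qed
  then obtain l where l: "y \<longlonglongrightarrow> l" by (auto simp: Cauchy_convergent_iff convergent_def)
  have "l \<in> S" using closed_sequentially[OF assms(2) _ l] yS by blast
  have "(norm (x - l))\<^sup>2 \<le> d\<^sup>2"
  proof (rule LIMSEQ_le)
    show "(\<lambda>n. (norm (x - y n))\<^sup>2) \<longlonglongrightarrow> (norm (x - l))\<^sup>2" by (intro tendsto_intros l)
    have "(\<lambda>n. d\<^sup>2 + inverse (real (Suc n))) \<longlonglongrightarrow> d\<^sup>2 + 0"
      by (intro tendsto_intros LIMSEQ_inverse_real_of_nat)
    then show "(\<lambda>n. d\<^sup>2 + inverse (real (Suc n))) \<longlonglongrightarrow> d\<^sup>2" by simp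
    show "\<exists>N. \<forall>n\<ge>N. (norm (x - y n))\<^sup>2 \<le> d\<^sup>2 + inverse (real (Suc n))"
      using y less_imp_le by (auto simp: inverse_eq_divide)
  qed
  then have "norm (x - l) \<le> d" using d0 power2_le_imp_le by blast
  with \<open>l \<in> S\<close> d_le show thesis by (intro that[of l]) force+
qed

text \<open>The closest point works: moving it along \<open>z\<close> cannot decrease the distance.\<close>
lemma orthogonal_decomposition:
  fixes S :: "'a::{real_inner, banach} set"
  assumes "subspace S" "closed S"
  obtains y where "y \<in> S" "\<And>z. z \<in> S \<Longrightarrow> inner (x - y) z = 0"
proof -
  obtain y where y: "y \<in> S" "\<And>z. z \<in> S \<Longrightarrow> norm (x - y) \<le> norm (x - z)"
    using closest_point_exists[OF assms] by blast
  show thesis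
  proof (rule that[OF y(1)])
    fix z assume z: "z \<in> S"
    show "inner (x - y) z = 0"
    proof (cases "z = 0")
      case False
      define t where "t = inner (x - y) z / inner z z"
      have zz: "inner z z > 0" using False by simp
      have "y + t *\<^sub>R z \<in> S" using assms y(1) z by (simp add: subspace_add subspace_scale)
      then have "(norm (x - y))\<^sup>2 \<le> (norm (x - (y + t *\<^sub>R z)))\<^sup>2"
        using y(2) by (simp add: power_mono)
      also have "\<dots> = (norm (x - y))\<^sup>2 - 2 * t * inner (x - y) z + t\<^sup>2 * inner z z"
        by (simp add: power2_norm_eq_inner inner_simps inner_commute algebra_simps power2_eq_square[of t])
      also have "\<dots> = (norm (x - y))\<^sup>2 - (inner (x - y) z)\<^sup>2 / inner z z"
        using zz by (simp add: t_def power2_eq_square)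
      finally have "(inner (x - y) z)\<^sup>2 / inner z z \<le> 0" by simp
      then show ?thesis using zz by (simp add: divide_le_0_iff)
    qed simp
  qed
qed

definition symmetric_op :: "('a::real_inner \<Rightarrow>\<^sub>L 'a) \<Rightarrow> bool" where
  "symmetric_op T \<longleftrightarrow> (\<forall>x y. inner (T x) y = inner x (T y))"

definition orth_projection :: "('a::real_inner \<Rightarrow>\<^sub>L 'a) \<Rightarrow> bool" where
  "orth_projection p \<longleftrightarrow> symmetric_op p \<and> (\<forall>x. p (p x) = p x)"

lemma symmetric_opD: "symmetric_op T \<Longrightarrow> inner (T x) y = inner x (T y)"
  by (simp add: symmetric_op_def)

lemma orth_projection_inner:
  assumes "orth_projection p"
  shows "inner x (p y) = inner (p x) (p y)" "inner (p x) y = inner (p x) (p y)"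
  using assms unfolding orth_projection_def symmetric_op_def by metis+

lemma orth_projection_idem: "orth_projection p \<Longrightarrow> p (p x) = p x"
  by (simp add: orth_projection_def)

lemma orth_projection_form: "orth_projection p \<Longrightarrow> inner x (p x) = (norm (p x))\<^sup>2"
  by (metis orth_projection_inner(1) power2_norm_eq_inner)

lemma orth_projection_pythagoras:
  assumes "orth_projection p"
  shows "(norm x)\<^sup>2 = (norm (p x))\<^sup>2 + (norm (x - p x))\<^sup>2"
  using orth_projection_inner[OF assms, of x x]
  by (simp add: power2_norm_eq_inner inner_simps)

lemma orth_projection_norm_le:
  assumes "orth_projection p"
  shows "norm (p x) \<le> norm x"
proof (rule power2_le_imp_le)
  show "(norm (p x))\<^sup>2 \<le> (norm x)\<^sup>2"
    using orth_projection_pythagoras[OF assms, of x] by simp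
qed simp

lemma orth_projection_compl:
  "orth_projection p \<Longrightarrow> orth_projection (id_blinfun - p)"
  unfolding orth_projection_def symmetric_op_def
  by (simp add: blinfun.bilinear_simps inner_simps)

lemma projection_onto_subspace:
  fixes S :: "'a::{real_inner, banach} set"
  assumes S: "subspace S" "closed S"
  obtains p where "orth_projection p" "\<And>x. p x = x \<longleftrightarrow> x \<in> S"
proof -
  have "\<forall>x. \<exists>y\<in>S. \<forall>z\<in>S. inner (x - y) z = 0"
    using orthogonal_decomposition[OF S] by metis
  then obtain f where fS: "\<And>x. f x \<in> S" and f: "\<And>x z. z \<in> S \<Longrightarrow> inner (x - f x) z = 0"
    by metis
  have uniq: "f x = y" if "y \<in> S" "\<And>z. z \<in> S \<Longrightarrow> inner (x - y) z = 0" for x y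
  proof -
    have "f x - y \<in> S" using S fS that by (simp add: subspace_diff)
    then have "inner (x - y) (f x - y) - inner (x - f x) (f x - y) = 0"
      using f that by simp
    then have "inner (f x - y) (f x - y) = 0" by (simp add: inner_simps)
    then show ?thesis by simp
  qed
  have "bounded_linear f"
  proof (rule bounded_linear_intro)
    show "f (x + y) = f x + f y" for x y
    proof (rule uniq)
      show "f x + f y \<in> S" using S fS by (simp add: subspace_add)
      show "inner (x + y - (f x + f y)) z = 0" if "z \<in> S" for z
        using f[OF that, of x] f[OF that, of y] by (simp add: inner_simps)
    qed
    show "f (r *\<^sub>R x) = r *\<^sub>R f x" for r x
    proof (rule uniq)
      show "r *\<^sub>R f x \<in> S" using S fS by (simp add: subspace_scale)
      show "inner (r *\<^sub>R x - r *\<^sub>R f x) z = 0" if "z \<in> S" for z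
        using f[OF that, of x] by (simp add: inner_simps)
    qed
    show "norm (f x) \<le> norm x * 1" for x
    proof (rule power2_le_imp_le)
      have "(norm x)\<^sup>2 = (norm (f x))\<^sup>2 + (norm (x - f x))\<^sup>2"
        using f[OF fS, of x x] by (simp add: power2_norm_eq_inner inner_simps inner_commute)
      then show "(norm (f x))\<^sup>2 \<le> (norm x * 1)\<^sup>2" by simp
    qed simp
  qed
  then have app: "blinfun_apply (Blinfun f) = f" by (rule bounded_linear_Blinfun_apply)
  show thesis
  proof (rule that)
    have fix_iff: "f x = x \<longleftrightarrow> x \<in> S" for x using uniq[of x x] fS[of x] by auto
    have "inner (f x) y = inner x (f y)" for x y
      using f[OF fS, of x y] f[OF fS, of y x] by (simp add: inner_simps inner_commute)
    then show "orth_projection (Blinfun f)"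
      using fS by (simp add: orth_projection_def symmetric_op_def app fix_iff)
    show "Blinfun f x = x \<longleftrightarrow> x \<in> S" for x by (simp add: app fix_iff)
  qed
qed

text \<open>The functional is determined by its value on a vector orthogonal to its kernel.\<close>
lemma riesz_representation:
  fixes f :: "'a::{real_inner, banach} \<Rightarrow> real"
  assumes f: "bounded_linear f"
  obtains y where "\<And>x. f x = inner y x"
proof (cases "\<forall>x. f x = 0")
  case True then show thesis by (intro that[of 0]) simp
next
  case False
  then obtain u where u: "f u \<noteq> 0" by blast
  interpret f: bounded_linear f by fact
  have "subspace {x. f x = 0}"
    by (simp add: subspace_def f.add f.scaleR f.zero)
  moreover have "closed {x. f x = 0}"
    by (intro closed_Collect_eq continuous_intros f.continuous_on)
  ultimately obtain v where v: "f v = 0" "\<And>z. f z = 0 \<Longrightarrow> inner (u - v) z = 0"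
    using orthogonal_decomposition[of "{x. f x = 0}" u] by auto
  define w where "w = u - v"
  have fw: "f w \<noteq> 0" using u v by (simp add: w_def f.diff)
  then have ww: "inner w w \<noteq> 0" using f.zero by auto
  show thesis
  proof (rule that)
    fix x
    have "f (x - (f x / f w) *\<^sub>R w) = 0" using fw by (simp add: f.diff f.scaleR)
    then have "inner w (x - (f x / f w) *\<^sub>R w) = 0" using v(2) unfolding w_def by blast
    then have "inner w x = f x / f w * inner w w" by (simp add: inner_simps)
    then show "f x = inner ((f w / inner w w) *\<^sub>R w) x" using fw ww by simp
  qed
qed

text \<open>The adjoint of the ambient theory is a definite description, so that even \<open>a = adj a\<close> says
  nothing before existence is established.\<close>
lemma real_adjoint_exists:
  fixes T :: "'a::{real_inner, banach} \<Rightarrow>\<^sub>L 'a"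
  obtains T' :: "'a \<Rightarrow>\<^sub>L 'a" where "\<And>x y. inner (T' x) y = inner x (T y)"
proof -
  have "\<forall>x. \<exists>z. \<forall>y. inner x (T y) = inner z y"
  proof
    fix x
    have "bounded_linear (\<lambda>y. inner x (T y))"
      by (rule bounded_linear_compose[OF bounded_linear_inner_right blinfun.bounded_linear_right])
    then show "\<exists>z. \<forall>y. inner x (T y) = inner z y" using riesz_representation by metis
  qed
  then obtain g where g: "\<And>x y. inner x (T y) = inner (g x) y" by metis
  have eqI: "u = v" if "\<And>y. inner u y = inner v y" for u v :: 'a
    using that by (metis vector_eq_rdot inner_commute)
  have "bounded_linear g"
  proof (rule bounded_linear_intro)
    show "g (x + y) = g x + g y" for x y
      by (rule eqI) (simp add: inner_add_left flip: g)
    show "g (r *\<^sub>R x) = r *\<^sub>R g x" for r x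
      by (rule eqI) (simp flip: g)
    show "norm (g x) \<le> norm x * norm T" for x
    proof (cases "g x = 0")
      case False
      have "(norm (g x))\<^sup>2 = inner x (T (g x))" by (simp add: g power2_norm_eq_inner)
      also have "\<dots> \<le> norm x * (norm T * norm (g x))"
        by (rule order_trans[OF norm_cauchy_schwarz]) (simp add: mult_left_mono norm_blinfun)
      finally show ?thesis using False by (simp add: power2_eq_square mult.assoc[symmetric])
    qed simp
  qed
  then show thesis
    by (intro that[of "Blinfun g"]) (simp add: bounded_linear_Blinfun_apply g)
qed

section \<open>The modulus of a symmetric operator\<close>

lemma blinfun_compose_simps:
  "(S + T) o\<^sub>L U = (S o\<^sub>L U) + (T o\<^sub>L U)" "U o\<^sub>L (S + T) = (U o\<^sub>L S) + (U o\<^sub>L T)"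
  "(S - T) o\<^sub>L U = (S o\<^sub>L U) - (T o\<^sub>L U)" "U o\<^sub>L (S - T) = (U o\<^sub>L S) - (U o\<^sub>L T)"
  "(r *\<^sub>R S) o\<^sub>L U = r *\<^sub>R (S o\<^sub>L U)" "U o\<^sub>L (r *\<^sub>R S) = r *\<^sub>R (U o\<^sub>L S)"
  "(U o\<^sub>L S) o\<^sub>L T = U o\<^sub>L (S o\<^sub>L T)" "id_blinfun o\<^sub>L U = U" "U o\<^sub>L id_blinfun = U"
  for S T U :: "'a::real_normed_vector \<Rightarrow>\<^sub>L 'a"
  by (auto intro!: blinfun_eqI simp: blinfun.bilinear_simps)

text \<open>If the iteration converges to \<open>B\<close>, then \<open>2 B = A + B\<^sup>2\<close>, that is, \<open>(1 - B)\<^sup>2 = 1 - A\<close>. So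
  this computes a square root of \<open>1 - A\<close>.\<close>
fun sqrt_iter :: "('a::real_normed_vector \<Rightarrow>\<^sub>L 'a) \<Rightarrow> nat \<Rightarrow> ('a \<Rightarrow>\<^sub>L 'a)" where
  "sqrt_iter A 0 = 0"
| "sqrt_iter A (Suc n) = (1/2) *\<^sub>R (A + (sqrt_iter A n o\<^sub>L sqrt_iter A n))"

text \<open>The scalar iteration for \<open>A = 1\<close>, which dominates the operator iteration for every contraction
  because all coefficients are nonnegative.\<close>
fun sqrt_bound :: "nat \<Rightarrow> real" where
  "sqrt_bound 0 = 0"
| "sqrt_bound (Suc n) = (1 + (sqrt_bound n)\<^sup>2) / 2"

lemma sqrt_bound: "0 \<le> sqrt_bound n" "sqrt_bound n \<le> 1"
  by (induction n) (auto simp: power_le_one)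

lemma sqrt_bound_mono: "sqrt_bound n \<le> sqrt_bound (Suc n)"
proof -
  have "2 * sqrt_bound (Suc n) - 2 * sqrt_bound n = (1 - sqrt_bound n)\<^sup>2"
    by (simp add: power2_eq_square algebra_simps)
  then show ?thesis by (metis diff_ge_0_iff_ge mult_le_cancel_left_pos zero_le_power2 zero_less_numeral)
qed

lemma sqrt_iter_commute:
  "A o\<^sub>L Y = Y o\<^sub>L A \<Longrightarrow> sqrt_iter A n o\<^sub>L Y = Y o\<^sub>L sqrt_iter A n"
proof (induction n)
  case (Suc n)
  have "(sqrt_iter A n o\<^sub>L sqrt_iter A n) o\<^sub>L Y = Y o\<^sub>L (sqrt_iter A n o\<^sub>L sqrt_iter A n)"
    using Suc by (metis blinfun_compose_simps(7))
  then show ?case using Suc.prems by (simp add: blinfun_compose_simps(1,2,5,6))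
qed simp

lemma sqrt_iter_norm: "norm A \<le> 1 \<Longrightarrow> norm (sqrt_iter A n) \<le> sqrt_bound n"
proof (induction n)
  case (Suc n)
  have "norm (sqrt_iter A n o\<^sub>L sqrt_iter A n) \<le> (sqrt_bound n)\<^sup>2"
    using Suc sqrt_bound(1)[of n]
    by (intro order_trans[OF norm_blinfun_compose]) (simp add: power2_eq_square mult_mono)
  then show ?case using Suc.prems norm_triangle_ineq[of A "sqrt_iter A n o\<^sub>L sqrt_iter A n"] by simp
qed simp

text \<open>All iterates are polynomials in \<open>A\<close> and commute, so both increments obey the same recursion,
  \<open>C\<^sup>2 - B\<^sup>2 = (C - B) (C + B)\<close>.\<close>
lemma sqrt_iter_increment:
  assumes "norm A \<le> 1"
  shows "norm (sqrt_iter A (Suc n) - sqrt_iter A n) \<le> sqrt_bound (Suc n) - sqrt_bound n"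
proof (induction n)
  case 0 then show ?case using assms by simp
next
  case (Suc n)
  let ?B = "sqrt_iter A n" and ?C = "sqrt_iter A (Suc n)"
  have comm: "?B o\<^sub>L ?C = ?C o\<^sub>L ?B"
    by (intro sqrt_iter_commute sqrt_iter_commute[symmetric] refl)
  have "sqrt_iter A (Suc (Suc n)) - ?C = (1/2) *\<^sub>R ((?C o\<^sub>L ?C) - (?B o\<^sub>L ?B))"
    by (subst sqrt_iter.simps(2), subst (3) sqrt_iter.simps(2)) (simp add: algebra_simps del: sqrt_iter.simps)
  also have "(?C o\<^sub>L ?C) - (?B o\<^sub>L ?B) = (?C - ?B) o\<^sub>L (?C + ?B)"
    using comm by (simp add: blinfun_compose_simps(1-4) del: sqrt_iter.simps)
  finally have half: "norm (sqrt_iter A (Suc (Suc n)) - ?C) = norm ((?C - ?B) o\<^sub>L (?C + ?B)) / 2"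
    by (simp del: sqrt_iter.simps)
  have "norm ((?C - ?B) o\<^sub>L (?C + ?B)) \<le> norm (?C - ?B) * norm (?C + ?B)"
    by (rule norm_blinfun_compose)
  also have "\<dots> \<le> (sqrt_bound (Suc n) - sqrt_bound n) * (sqrt_bound (Suc n) + sqrt_bound n)"
  proof (rule mult_mono)
    show "norm (?C + ?B) \<le> sqrt_bound (Suc n) + sqrt_bound n"
      by (rule order_trans[OF norm_triangle_ineq add_mono]) (rule sqrt_iter_norm[OF assms])+
  qed (use Suc sqrt_bound_mono[of n] in simp_all)
  also have "(sqrt_bound (Suc n) - sqrt_bound n) * (sqrt_bound (Suc n) + sqrt_bound n)
      = 2 * (sqrt_bound (Suc (Suc n)) - sqrt_bound (Suc n))"
    unfolding sqrt_bound.simps(2)[of "Suc n"] square_diff_square_factored[symmetric]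
    by (simp add: power2_eq_square algebra_simps)
  finally have "norm ((?C - ?B) o\<^sub>L (?C + ?B)) / 2 \<le> sqrt_bound (Suc (Suc n)) - sqrt_bound (Suc n)"
    by (subst divide_le_eq_numeral1) (simp only: mult.commute)
  with half show ?case by (simp only:)
qed

lemma sqrt_iter_convergent:
  fixes A :: "'a::banach \<Rightarrow>\<^sub>L 'a"
  assumes "norm A \<le> 1"
  shows "convergent (sqrt_iter A)"
proof -
  have "incseq sqrt_bound" by (rule incseq_SucI) (rule sqrt_bound_mono)
  then have "convergent sqrt_bound"
    using incseq_convergent[of sqrt_bound 1] sqrt_bound(2) convergentI by metis
  then have "summable (\<lambda>n. sqrt_bound (Suc n) - sqrt_bound n)"
    unfolding convergent_def by (blast intro: telescope_summable)
  then have "summable (\<lambda>n. norm (sqrt_iter A (Suc n) - sqrt_iter A n))"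
    by (rule summable_comparison_test'[where N = 0])
      (use sqrt_iter_increment[OF assms] in auto)
  then have "summable (\<lambda>n. sqrt_iter A (Suc n) - sqrt_iter A n)" by (rule summable_norm_cancel)
  then have "convergent (\<lambda>n. \<Sum>k<n. sqrt_iter A (Suc k) - sqrt_iter A k)"
    by (simp add: summable_iff_convergent)
  then show ?thesis by (simp add: sum_lessThan_telescope del: sqrt_iter.simps(2))
qed

lemma symmetric_op_sqrt_iter: "symmetric_op A \<Longrightarrow> symmetric_op (sqrt_iter A n)"
  by (induction n) (simp_all add: symmetric_op_def blinfun.bilinear_simps inner_simps)

text \<open>The modulus is the limit of the iteration for \<open>A = 1 - x\<^sup>2\<close>, subtracted from \<open>1\<close>; it is
  positive since that limit is a contraction, and it commutes with \<open>x\<close> since every iterate does.\<close>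
lemma modulus_exists:
  fixes x :: "'a::{real_inner, banach} \<Rightarrow>\<^sub>L 'a"
  assumes sym: "symmetric_op x" and norm1: "norm x \<le> 1"
  obtains q where "symmetric_op q" "\<And>v. 0 \<le> inner v (q v)" "q o\<^sub>L q = x o\<^sub>L x" "q o\<^sub>L x = x o\<^sub>L q"
proof -
  define A where "A = id_blinfun - (x o\<^sub>L x)"
  have symA: "symmetric_op A"
    using sym by (simp add: A_def symmetric_op_def blinfun.bilinear_simps inner_simps)
  have contr: "norm (x v) \<le> norm v" for v
    using norm_blinfun[of x v] norm1 mult_right_mono[of "norm x" 1 "norm v"] by simp
  have normA: "norm A \<le> 1"
  proof (rule norm_blinfun_bound)
    fix v
    have "(norm (A v))\<^sup>2 = (norm v)\<^sup>2 - 2 * (norm (x v))\<^sup>2 + (norm (x (x v)))\<^sup>2"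
      using sym by (simp add: A_def symmetric_op_def power2_norm_eq_inner blinfun.bilinear_simps
          inner_simps inner_commute)
    also have "\<dots> \<le> (norm v)\<^sup>2"
      using power_mono[OF contr[of "x v"] norm_ge_zero, of 2] zero_le_power2[of "norm (x v)"]
      by linarith
    finally show "norm (A v) \<le> 1 * norm v" using power2_le_imp_le norm_ge_zero by force
  qed simp
  obtain B where B: "sqrt_iter A \<longlonglongrightarrow> B"
    using sqrt_iter_convergent[OF normA] by (auto simp: convergent_def)
  have Bv: "(\<lambda>n. sqrt_iter A n v) \<longlonglongrightarrow> B v" for v
    by (intro tendsto_intros B)
  have "(\<lambda>n. sqrt_iter A (Suc n)) \<longlonglongrightarrow> (1/2) *\<^sub>R (A + (B o\<^sub>L B))"
    unfolding sqrt_iter.simps(2)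
    by (intro tendsto_intros bounded_bilinear.tendsto[OF bounded_bilinear_blinfun_compose] B)
  then have BB: "B = (1/2) *\<^sub>R (A + (B o\<^sub>L B))" using LIMSEQ_Suc[OF B] LIMSEQ_unique by blast
  have symB: "symmetric_op B"
    unfolding symmetric_op_def
  proof (intro allI)
    fix u v
    have "(\<lambda>n. inner (sqrt_iter A n u) v) \<longlonglongrightarrow> inner (B u) v"
      "(\<lambda>n. inner u (sqrt_iter A n v)) \<longlonglongrightarrow> inner u (B v)"
      by (intro tendsto_intros Bv)+
    then show "inner (B u) v = inner u (B v)"
      unfolding symmetric_opD[OF symmetric_op_sqrt_iter[OF symA]] by (rule LIMSEQ_unique)
  qed
  have Bx: "B o\<^sub>L x = x o\<^sub>L B"
  proof -
    have "A o\<^sub>L x = x o\<^sub>L A" by (simp add: A_def blinfun_compose_simps)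
    then have comm: "sqrt_iter A n o\<^sub>L x = x o\<^sub>L sqrt_iter A n" for n by (rule sqrt_iter_commute)
    have "(\<lambda>n. sqrt_iter A n o\<^sub>L x) \<longlonglongrightarrow> (B o\<^sub>L x)" "(\<lambda>n. x o\<^sub>L sqrt_iter A n) \<longlonglongrightarrow> (x o\<^sub>L B)"
      by (intro bounded_bilinear.tendsto[OF bounded_bilinear_blinfun_compose] B tendsto_const)+
    then show ?thesis unfolding comm by (rule LIMSEQ_unique)
  qed
  have normB: "norm B \<le> 1"
    using sqrt_iter_norm[OF normA] sqrt_bound(2)
    by (intro LIMSEQ_le_const2[OF tendsto_norm[OF B]]) (meson order_trans)
  define q where "q = id_blinfun - B"
  show thesis
  proof (rule that)
    show "symmetric_op q"
      using symB by (simp add: q_def symmetric_op_def blinfun.bilinear_simps inner_simps)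
    show "q o\<^sub>L x = x o\<^sub>L q" by (simp add: q_def blinfun_compose_simps Bx)
    show "q o\<^sub>L q = x o\<^sub>L x"
    proof -
      have "q o\<^sub>L q = id_blinfun - 2 *\<^sub>R B + (B o\<^sub>L B)"
        by (simp add: q_def blinfun_compose_simps scaleR_2 algebra_simps)
      also have "2 *\<^sub>R B = A + (B o\<^sub>L B)" using arg_cong[OF BB, of "scaleR 2"] by simp
      finally show ?thesis by (simp add: A_def)
    qed
    show "0 \<le> inner v (q v)" for v
    proof -
      have "inner v (B v) \<le> norm v * (norm B * norm v)"
        by (rule order_trans[OF norm_cauchy_schwarz]) (simp add: mult_left_mono norm_blinfun)
      also have "\<dots> \<le> norm v * (1 * norm v)"
        using normB by (intro mult_left_mono mult_right_mono) auto
      finally show ?thesis by (simp add: q_def blinfun.bilinear_simps inner_simps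
            flip: power2_norm_eq_inner power2_eq_square)
    qed
  qed
qed

section \<open>Spectral subspaces\<close>

lemma subspace_blinfun_kernel: "subspace {v. blinfun_apply T v = 0}"
proof (rule subspaceI)
qed (simp_all only: mem_Collect_eq blinfun.bilinear_simps add_0_left scaleR_zero_right)

text \<open>With \<open>q\<close> the modulus of \<open>x\<close>, the subspace is the kernel of \<open>q + x\<close>. There \<open>x = - q \<le> 0\<close>. Since
  \<open>(q + x) (q - x) = 0\<close>, the range of \<open>q - x\<close> is contained in the kernel, so \<open>q - x\<close> vanishes on its
  orthogonal complement, where therefore \<open>x = q \<ge> 0\<close>.\<close>
lemma sign_decomposition:
  fixes x :: "'a::{real_inner, banach} \<Rightarrow>\<^sub>L 'a"
  assumes sym: "symmetric_op x"
  obtains N where "subspace N" "closed N" "\<And>v. v \<in> N \<Longrightarrow> x v \<in> N"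
    "\<And>v. v \<in> N \<Longrightarrow> inner v (x v) \<le> 0"
    "\<And>v. (\<And>z. z \<in> N \<Longrightarrow> inner v z = 0) \<Longrightarrow> 0 \<le> inner v (x v)"
proof -
  \<comment> \<open>Rescale to a contraction; adding 1 avoids dividing by zero for \<open>x = 0\<close>.\<close>
  define c where "c = inverse (norm x + 1)"
  have c: "c > 0" by (simp add: c_def add_nonneg_pos)
  have "norm (c *\<^sub>R x) = norm x / (norm x + 1)"
    by (simp add: c_def divide_inverse_commute)
  then have "norm (c *\<^sub>R x) \<le> 1" by (simp add: divide_le_eq_1 add_nonneg_pos)
  moreover have "symmetric_op (c *\<^sub>R x)"
    using sym by (simp add: symmetric_op_def blinfun.bilinear_simps)
  ultimately obtain q where symq: "symmetric_op q" and pos: "\<And>v. 0 \<le> inner v (q v)"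
    and qq: "q o\<^sub>L q = (c *\<^sub>R x) o\<^sub>L (c *\<^sub>R x)" and qx: "q o\<^sub>L (c *\<^sub>R x) = (c *\<^sub>R x) o\<^sub>L q"
    using modulus_exists by metis
  have qqv: "q (q v) = c *\<^sub>R x (c *\<^sub>R x v)" for v
    using arg_cong[OF qq, of "\<lambda>T. blinfun_apply T v"] by (simp add: blinfun.bilinear_simps)
  have qxv: "q (x v) = x (q v)" for v
    using arg_cong[OF qx, of "\<lambda>T. blinfun_apply T v"] c by (simp add: blinfun.bilinear_simps)
  define N where "N = {v. q v + c *\<^sub>R x v = 0}"
  show thesis
  proof (rule that)
    have "N = {v. (q + c *\<^sub>R x) v = 0}" by (simp add: N_def blinfun.bilinear_simps)
    then show "subspace N" by (simp only:) (rule subspace_blinfun_kernel)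
    show "closed N"
      unfolding N_def by (intro closed_Collect_eq continuous_intros)
    show "x v \<in> N" if "v \<in> N" for v
    proof -
      have "q (x v) + c *\<^sub>R x (x v) = x (q v + c *\<^sub>R x v)"
        by (simp add: qxv blinfun.bilinear_simps)
      also have "\<dots> = 0" using that by (simp add: N_def blinfun.zero_right)
      finally show ?thesis by (simp add: N_def)
    qed
    show "inner v (x v) \<le> 0" if "v \<in> N" for v
    proof -
      have "c *\<^sub>R x v = - q v" using that by (simp add: N_def add_eq_0_iff)
      then have "c * inner v (x v) = - inner v (q v)" by (metis inner_minus_right inner_scaleR_right)
      then have "c * inner v (x v) \<le> 0" using pos[of v] by simp
      then show ?thesis using c by (simp add: mult_le_0_iff)
    qed
    show "0 \<le> inner v (x v)" if v: "\<And>z. z \<in> N \<Longrightarrow> inner v z = 0" for v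
    proof -
      have "inner (q v - c *\<^sub>R x v) u = 0" for u
      proof -
        have "q u - c *\<^sub>R x u \<in> N"
          by (simp add: N_def blinfun.bilinear_simps qqv qxv scaleR_diff_right)
        then have "inner v (q u - c *\<^sub>R x u) = 0" by (rule v)
        then show ?thesis
          using symmetric_opD[OF symq] symmetric_opD[OF sym] by (simp add: inner_simps)
      qed
      then have "q v - c *\<^sub>R x v = 0" by (metis inner_eq_zero_iff)
      then have "c * inner v (x v) = inner v (q v)" by (metis eq_iff_diff_eq_0 inner_scaleR_right)
      then show ?thesis using c pos[of v] by (metis zero_le_mult_iff not_less)
    qed
  qed
qed

text \<open>Log-convexity makes the ratios of successive terms increase, so a single ratio above \<open>r\<close> would
  lead to growth faster than \<open>C * r\<^sup>n\<close>. The lemma holds for negative \<open>r\<close> as well, where all terms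
  must vanish.\<close>
lemma log_convex_growth:
  fixes a :: "nat \<Rightarrow> real"
  assumes nonneg: "\<And>n. 0 \<le> a n" and convex: "\<And>n. (a (Suc n))\<^sup>2 \<le> a n * a (Suc (Suc n))"
    and bound: "\<And>n. a n \<le> C * r ^ n"
  shows "a n \<le> r ^ n * a 0"
proof -
  have first: "a 1 \<le> r * a 0"
    if nonneg: "\<And>n. 0 \<le> a n" and convex: "\<And>n. (a (Suc n))\<^sup>2 \<le> a n * a (Suc (Suc n))"
      and bound: "\<And>n. a n \<le> C * r ^ n" for a :: "nat \<Rightarrow> real" and C
  proof (rule ccontr)
    assume "\<not> a 1 \<le> r * a 0"
    then have gt: "r * a 0 < a 1" by simp
    have a0: "0 < a 0"
    proof (rule ccontr)
      assume "\<not> 0 < a 0"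
      then have "a 0 = 0" using nonneg[of 0] by simp
      then show False using convex[of 0] gt by simp
    qed
    define \<rho> where "\<rho> = a 1 / a 0"
    have \<rho>: "r < \<rho>" "0 \<le> \<rho>" using gt a0 nonneg[of 1] by (auto simp: \<rho>_def field_simps)
    have r: "0 < r"
    proof (rule ccontr)
      assume "\<not> 0 < r"
      then have "r \<le> 0" by simp
      moreover have "0 < C" using a0 bound[of 0] by simp
      ultimately have "C * r \<le> 0" by (simp add: mult_le_0_iff)
      then have "a 1 = 0" using bound[of 1] nonneg[of 1] by simp
      then have "r * a 0 < 0" using gt by simp
      then have "r < 0" using a0 by (simp add: mult_less_0_iff)
      then have "C * r < 0" using \<open>0 < C\<close> by (simp add: mult_pos_neg)
      then show False using bound[of 1] nonneg[of 1] by simp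
    qed
    have grow: "0 < a n \<and> \<rho> * a n \<le> a (Suc n)" for n
    proof (induction n)
      case 0 then show ?case using a0 by (simp add: \<rho>_def)
    next
      case (Suc n)
      then have "0 < \<rho> * a n" using \<rho> r by simp
      then have pos: "0 < a (Suc n)" using Suc by linarith
      have "\<rho> * a n * a (Suc n) \<le> a (Suc n) * a (Suc n)"
        using Suc pos by (intro mult_right_mono) auto
      also have "\<dots> \<le> a n * a (Suc (Suc n))" using convex[of n] by (simp add: power2_eq_square)
      finally have "a n * (\<rho> * a (Suc n)) \<le> a n * a (Suc (Suc n))" by (simp add: algebra_simps)
      then show ?case using Suc pos by simp
    qed
    have power: "\<rho> ^ n * a 0 \<le> a n" for n
    proof (induction n)
      case (Suc n)
      have "\<rho> ^ Suc n * a 0 = \<rho> * (\<rho> ^ n * a 0)" by simp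
      also have "\<dots> \<le> \<rho> * a n" using Suc \<rho> by (intro mult_left_mono) auto
      finally show ?case using grow[of n] by linarith
    qed simp
    obtain n where n: "C / a 0 < (\<rho> / r) ^ n"
      using real_arch_pow[of "\<rho> / r" "C / a 0"] \<rho> r by auto
    then have "C * r ^ n < \<rho> ^ n * a 0"
      using a0 r by (simp add: power_divide field_simps)
    then show False using power[of n] bound[of n] by linarith
  qed
  have step: "a (Suc n) \<le> r * a n" for n
  proof -
    have "a (n + k) \<le> C * r ^ n * r ^ k" for k using bound[of "n + k"] by (simp add: power_add mult.assoc)
    then show ?thesis using first[of "\<lambda>k. a (n + k)" "C * r ^ n"] nonneg convex by simp
  qed
  show ?thesis
  proof (cases "r < 0")
    case True
    have "a k = 0" for k
    proof (rule ccontr)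
      assume "a k \<noteq> 0"
      then have "r * a k < 0" using nonneg[of k] True by (simp add: mult_neg_pos)
      then show False using step[of k] nonneg[of "Suc k"] by linarith
    qed
    then show ?thesis by simp
  next
    case False
    show ?thesis
    proof (induction n)
      case (Suc n)
      have "a (Suc n) \<le> r * (r ^ n * a 0)"
        using step[of n] mult_left_mono[OF Suc, of r] False by linarith
      then show ?case by (simp add: mult.assoc)
    qed simp
  qed
qed

text \<open>The constant is \<open>norm v\<close> so that the set is evidently closed and right-continuous in \<open>r\<close>;
  for symmetric operators any other constant gives the same set, which makes it a subspace.\<close>
definition growth_space :: "('a::real_inner \<Rightarrow>\<^sub>L 'a) \<Rightarrow> real \<Rightarrow> 'a set" where
  "growth_space T r = {v. \<forall>n. norm ((blinfun_apply T ^^ n) v) \<le> r ^ n * norm v}"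

lemma bounded_linear_funpow: "bounded_linear (blinfun_apply T ^^ n)"
  for T :: "'a::real_normed_vector \<Rightarrow>\<^sub>L 'a"
proof (induction n)
  case 0 then show ?case by (simp add: id_def)
next
  case (Suc n)
  show ?case
    using bounded_linear_compose[OF blinfun.bounded_linear_right[of T] Suc] by (simp add: o_def)
qed

text \<open>\<open>norm (T\<^sup>n v)\<close> is log-convex in \<open>n\<close> by the Cauchy-Schwarz inequality.\<close>
lemma growth_space_iff:
  assumes "symmetric_op T"
  shows "v \<in> growth_space T r \<longleftrightarrow> (\<exists>C. \<forall>n. norm ((blinfun_apply T ^^ n) v) \<le> C * r ^ n)"
proof
  assume "v \<in> growth_space T r"
  then show "\<exists>C. \<forall>n. norm ((blinfun_apply T ^^ n) v) \<le> C * r ^ n"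
    unfolding growth_space_def by (auto intro!: exI[of _ "norm v"] simp: mult.commute)
next
  assume "\<exists>C. \<forall>n. norm ((blinfun_apply T ^^ n) v) \<le> C * r ^ n"
  then obtain C where C: "\<And>n. norm ((blinfun_apply T ^^ n) v) \<le> C * r ^ n" by blast
  have "(norm ((blinfun_apply T ^^ Suc n) v))\<^sup>2
      \<le> norm ((blinfun_apply T ^^ n) v) * norm ((blinfun_apply T ^^ Suc (Suc n)) v)" for n
  proof -
    have "(norm ((blinfun_apply T ^^ Suc n) v))\<^sup>2
        = inner ((blinfun_apply T ^^ n) v) ((blinfun_apply T ^^ Suc (Suc n)) v)"
      using symmetric_opD[OF assms] by (simp add: power2_norm_eq_inner)
    also have "\<dots> \<le> norm ((blinfun_apply T ^^ n) v) * norm ((blinfun_apply T ^^ Suc (Suc n)) v)"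
      by (rule norm_cauchy_schwarz)
    finally show ?thesis .
  qed
  from log_convex_growth[of "\<lambda>n. norm ((blinfun_apply T ^^ n) v)", OF norm_ge_zero this C]
  show "v \<in> growth_space T r" by (simp add: growth_space_def)
qed

lemma subspace_growth_space:
  assumes "symmetric_op T"
  shows "subspace (growth_space T r)"
proof (rule subspaceI)
  show "0 \<in> growth_space T r"
    by (simp add: growth_space_def linear_0[OF bounded_linear.linear[OF bounded_linear_funpow]])
next
  fix v w assume "v \<in> growth_space T r" "w \<in> growth_space T r"
  then obtain C D where "\<And>n. norm ((blinfun_apply T ^^ n) v) \<le> C * r ^ n"
    and "\<And>n. norm ((blinfun_apply T ^^ n) w) \<le> D * r ^ n"
    unfolding growth_space_iff[OF assms] by blast
  then have "norm ((blinfun_apply T ^^ n) (v + w)) \<le> (C + D) * r ^ n" for n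
    unfolding linear_add[OF bounded_linear.linear[OF bounded_linear_funpow]] distrib_right
    by (intro order_trans[OF norm_triangle_ineq] add_mono)
  then show "v + w \<in> growth_space T r" unfolding growth_space_iff[OF assms] by blast
next
  fix k :: real and v assume v: "v \<in> growth_space T r"
  show "k *\<^sub>R v \<in> growth_space T r"
    unfolding growth_space_def
  proof (intro CollectI allI)
    fix n
    have "norm ((blinfun_apply T ^^ n) v) \<le> r ^ n * norm v" using v by (simp add: growth_space_def)
    from mult_left_mono[OF this, of "\<bar>k\<bar>"]
    show "norm ((blinfun_apply T ^^ n) (k *\<^sub>R v)) \<le> r ^ n * norm (k *\<^sub>R v)"
      by (simp add: linear_scale[OF bounded_linear.linear[OF bounded_linear_funpow]] algebra_simps)
  qed
qed

lemma closed_growth_space: "closed (growth_space T r)"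
  unfolding growth_space_def
  by (intro closed_Collect_all closed_Collect_le continuous_intros
      linear_continuous_on[OF bounded_linear_funpow])

lemma growth_space_neg:
  assumes "r < 0"
  shows "growth_space T r = {0}"
proof -
  have "v = 0" if "v \<in> growth_space T r" for v
  proof -
    have "norm ((blinfun_apply T ^^ 1) v) \<le> r ^ 1 * norm v"
      using that unfolding growth_space_def by blast
    then have "0 \<le> r * norm v" using norm_ge_zero[of "T v"] by (simp del: norm_ge_zero)
    then show ?thesis using assms by (simp add: zero_le_mult_iff)
  qed
  moreover have "0 \<in> growth_space T r"
    by (simp add: growth_space_def linear_0[OF bounded_linear.linear[OF bounded_linear_funpow]])
  ultimately show ?thesis by blast
qed

lemma growth_space_mono:
  assumes "symmetric_op T" "r \<le> s"
  shows "growth_space T r \<subseteq> growth_space T s"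
proof (cases "r < 0")
  case True
  then show ?thesis using subspace_0[OF subspace_growth_space[OF assms(1)]] by (simp add: growth_space_neg)
next
  case False
  have "r ^ n * norm v \<le> s ^ n * norm v" for n and v :: 'a
    using False assms(2) by (intro mult_right_mono power_mono) auto
  then show ?thesis unfolding growth_space_def by (blast intro: order_trans)
qed

lemma growth_space_right_continuous:
  assumes "\<And>s. r < s \<Longrightarrow> v \<in> growth_space T s"
  shows "v \<in> growth_space T r"
  unfolding growth_space_def
proof (intro CollectI allI)
  fix n
  have "((\<lambda>s. s ^ n * norm v) \<longlongrightarrow> r ^ n * norm v) (at_right r)" by (intro tendsto_intros)
  then show "norm ((blinfun_apply T ^^ n) v) \<le> r ^ n * norm v"
    by (rule tendsto_lowerbound)
      (use assms in \<open>auto simp: growth_space_def eventually_at_right_field intro!: exI[of _ "r + 1"]\<close>)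
qed

lemma growth_space_UNIV:
  assumes "norm T \<le> r"
  shows "growth_space T r = UNIV"
proof -
  have "norm ((blinfun_apply T ^^ n) v) \<le> r ^ n * norm v" for n v
  proof (induction n)
    case (Suc n)
    have "norm ((blinfun_apply T ^^ Suc n) v) \<le> norm T * norm ((blinfun_apply T ^^ n) v)"
      by (simp add: norm_blinfun)
    also have "\<dots> \<le> r * (r ^ n * norm v)"
      using assms Suc order_trans[OF norm_ge_zero assms] by (intro mult_mono) auto
    finally show ?case by (simp add: mult.assoc)
  qed simp
  then show ?thesis by (auto simp: growth_space_def)
qed

lemma growth_space_invariant:
  fixes y :: "'a::real_inner \<Rightarrow>\<^sub>L 'a"
  assumes "symmetric_op T" and comm: "\<And>u. T (y u) = y (T u)" and v: "v \<in> growth_space T r"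
  shows "blinfun_apply y v \<in> growth_space T r"
proof -
  have "(blinfun_apply T ^^ n) (y v) = y ((blinfun_apply T ^^ n) v)" for n
    by (induction n) (simp_all add: comm)
  moreover have "norm (y ((blinfun_apply T ^^ n) v)) \<le> (norm y * norm v) * r ^ n" for n
  proof -
    have "norm (y ((blinfun_apply T ^^ n) v)) \<le> norm y * norm ((blinfun_apply T ^^ n) v)"
      by (rule norm_blinfun)
    also have "\<dots> \<le> norm y * (r ^ n * norm v)"
      using v by (intro mult_left_mono) (auto simp: growth_space_def)
    finally show ?thesis by (simp add: algebra_simps)
  qed
  ultimately show ?thesis unfolding growth_space_iff[OF assms(1)] by (metis (no_types))
qed

lemma growth_space_upper:
  assumes "v \<in> growth_space T r"
  shows "inner v (T v) \<le> r * (norm v)\<^sup>2"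
proof -
  have "norm ((blinfun_apply T ^^ 1) v) \<le> r ^ 1 * norm v"
    using assms unfolding growth_space_def by blast
  then have "norm v * norm (T v) \<le> norm v * (r * norm v)" by (intro mult_left_mono) auto
  then show ?thesis
    using norm_cauchy_schwarz[of v "T v"] by (simp add: power2_eq_square algebra_simps)
qed

text \<open>Let \<open>N\<close> be a \<open>T\<close>-invariant subspace with \<open>T \<le> r\<close> on \<open>N\<close> and \<open>T \<ge> r\<close> on its complement. On
  \<open>N\<close>, \<open>0 \<le> T \<le> r\<close> implies \<open>norm (T u) \<le> r * norm u\<close>, so \<open>N\<close> lies in the growth space, and vectors
  orthogonal to the growth space are orthogonal to \<open>N\<close>.\<close>
lemma growth_space_lower:
  fixes T :: "'a::{real_inner, banach} \<Rightarrow>\<^sub>L 'a"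
  assumes sym: "symmetric_op T" and pos: "\<And>u. 0 \<le> inner u (T u)"
    and v: "\<And>z. z \<in> growth_space T r \<Longrightarrow> inner v z = 0"
  shows "r * (norm v)\<^sup>2 \<le> inner v (T v)"
proof (cases "r < 0")
  case True
  then have "r * (norm v)\<^sup>2 \<le> 0" by (simp add: mult_nonpos_nonneg)
  then show ?thesis using pos[of v] by linarith
next
  case False
  have app: "blinfun_apply (T - r *\<^sub>R id_blinfun) u = T u - r *\<^sub>R u" for u
    by (simp add: blinfun.bilinear_simps)
  have "symmetric_op (T - r *\<^sub>R id_blinfun)"
    using sym by (simp add: symmetric_op_def app inner_simps)
  then obtain N where N: "subspace N" and inv: "\<And>u. u \<in> N \<Longrightarrow> T u - r *\<^sub>R u \<in> N"
    and upper: "\<And>u. u \<in> N \<Longrightarrow> inner u (T u - r *\<^sub>R u) \<le> 0"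
    and lower: "\<And>u. (\<And>z. z \<in> N \<Longrightarrow> inner u z = 0) \<Longrightarrow> 0 \<le> inner u (T u - r *\<^sub>R u)"
    by (rule sign_decomposition) (auto simp: app)
  have invT: "T u \<in> N" if "u \<in> N" for u
    using subspace_add[OF N inv[OF that] subspace_scale[OF N that, of r]] by simp
  have upperT: "inner u (T u) \<le> r * (norm u)\<^sup>2" if "u \<in> N" for u
    using upper[OF that] by (simp add: inner_simps power2_norm_eq_inner)
  have bound: "norm (T u) \<le> r * norm u" if u: "u \<in> N" for u
  proof -
    \<comment> \<open>Evaluate the positive form of \<open>T\<close> at \<open>u - T u / s\<close>. The free parameter \<open>s\<close> covers \<open>r = 0\<close>.\<close>
    have key: "(norm (T u))\<^sup>2 \<le> s * inner u (T u)" if "r \<le> s" "0 < s" for s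
    proof -
      define w where "w = u - (1/s) *\<^sub>R T u"
      have "inner (T u) (T (T u)) \<le> s * (norm (T u))\<^sup>2"
        using upperT[OF invT[OF u]] mult_right_mono[OF that(1), of "(norm (T u))\<^sup>2"] by simp
      have "0 \<le> inner w (T w)" by (rule pos)
      also have "inner w (T w) = inner u (T u) - (2/s) * (norm (T u))\<^sup>2
          + (1/s)\<^sup>2 * inner (T u) (T (T u))"
        using symmetric_opD[OF sym, of u "T u"]
        by (simp add: w_def blinfun.bilinear_simps inner_simps power2_norm_eq_inner power2_eq_square[of s]
           power_divide inner_commute algebra_simps)
      also have "\<dots> \<le> inner u (T u) - (2/s) * (norm (T u))\<^sup>2 + (1/s)\<^sup>2 * (s * (norm (T u))\<^sup>2)"
        using \<open>inner (T u) (T (T u)) \<le> _\<close> by (intro add_left_mono mult_left_mono) auto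
      also have "\<dots> = inner u (T u) - (norm (T u))\<^sup>2 / s"
        using that by (simp add: field_simps power2_eq_square)
      finally show ?thesis using that by (simp add: field_simps)
    qed
    have "(norm (T u))\<^sup>2 \<le> (r * norm u)\<^sup>2"
    proof (cases "r = 0")
      case True
      then show ?thesis using key[of 1] upperT[OF u] by (auto dest: order_trans)
    next
      case nz: False
      then have "(norm (T u))\<^sup>2 \<le> r * (r * (norm u)\<^sup>2)"
        using key[of r] mult_left_mono[OF upperT[OF u], of r] False by linarith
      then show ?thesis by (simp add: power_mult_distrib power2_eq_square algebra_simps)
    qed
    then show ?thesis using False power2_le_imp_le[of "norm (T u)" "r * norm u"] by simp
  qed
  have "N \<subseteq> growth_space T r"
  proof
    fix u assume "u \<in> N"
    have "(blinfun_apply T ^^ n) u \<in> N \<and> norm ((blinfun_apply T ^^ n) u) \<le> r ^ n * norm u" for n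
    proof (induction n)
      case (Suc n)
      then have "norm (T ((blinfun_apply T ^^ n) u)) \<le> r * (r ^ n * norm u)"
        using bound[of "(blinfun_apply T ^^ n) u"] False
          mult_left_mono[of "norm ((blinfun_apply T ^^ n) u)" "r ^ n * norm u" r] by linarith
      then show ?case using Suc invT by (simp add: mult.assoc)
    qed (simp add: \<open>u \<in> N\<close>)
    then show "u \<in> growth_space T r" by (simp add: growth_space_def)
  qed
  then have "0 \<le> inner v (T v - r *\<^sub>R v)" using lower v by blast
  then show ?thesis by (simp add: inner_simps power2_norm_eq_inner)
qed

text \<open>The spectral subspace of \<open>c\<close> for \<open>(-\<infinity>, s]\<close>. The growth of powers compares absolute values of
  spectral points, hence the shift of \<open>c\<close> to a positive operator.\<close>
definition spectral_subspace :: "('a::real_inner \<Rightarrow>\<^sub>L 'a) \<Rightarrow> real \<Rightarrow> 'a set" where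
  "spectral_subspace c s = growth_space (c + norm c *\<^sub>R id_blinfun) (s + norm c)"

lemma shift_symmetric: "symmetric_op c \<Longrightarrow> symmetric_op (c + k *\<^sub>R id_blinfun)"
  by (simp add: symmetric_op_def blinfun.bilinear_simps inner_simps)

lemma shift_positive: "0 \<le> inner u ((c + norm c *\<^sub>R id_blinfun) u)"
  for c :: "'a::real_inner \<Rightarrow>\<^sub>L 'a"
proof -
  have "\<bar>inner u (c u)\<bar> \<le> norm u * norm (c u)" by (rule Cauchy_Schwarz_ineq2)
  also have "\<dots> \<le> norm u * (norm c * norm u)" by (intro mult_left_mono norm_blinfun) simp
  finally show ?thesis
    by (simp add: blinfun.bilinear_simps inner_simps power2_eq_square algebra_simps
        flip: power2_norm_eq_inner)
qed

lemma subspace_spectral_subspace: "symmetric_op c \<Longrightarrow> subspace (spectral_subspace c s)"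
  unfolding spectral_subspace_def by (intro subspace_growth_space shift_symmetric)

lemma closed_spectral_subspace: "closed (spectral_subspace c s)"
  unfolding spectral_subspace_def by (rule closed_growth_space)

lemma spectral_subspace_mono:
  "symmetric_op c \<Longrightarrow> s \<le> t \<Longrightarrow> spectral_subspace c s \<subseteq> spectral_subspace c t"
  unfolding spectral_subspace_def by (intro growth_space_mono shift_symmetric) auto

lemma spectral_subspace_right_continuous:
  assumes "\<And>t. s < t \<Longrightarrow> v \<in> spectral_subspace c t"
  shows "v \<in> spectral_subspace c s"
  unfolding spectral_subspace_def
proof (rule growth_space_right_continuous)
  fix t assume "s + norm c < t"
  then show "v \<in> growth_space (c + norm c *\<^sub>R id_blinfun) t"
    using assms[of "t - norm c"] by (simp add: spectral_subspace_def)
qed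

lemma spectral_subspace_trivial: "s < - norm c \<Longrightarrow> spectral_subspace c s = {0}"
  unfolding spectral_subspace_def by (rule growth_space_neg) simp

lemma spectral_subspace_UNIV:
  assumes "norm c \<le> s"
  shows "spectral_subspace c s = UNIV"
  unfolding spectral_subspace_def
proof (rule growth_space_UNIV)
  have "norm (id_blinfun :: 'a \<Rightarrow>\<^sub>L 'a) \<le> 1" by (rule norm_blinfun_id_le)
  then have "norm c * norm (id_blinfun :: 'a \<Rightarrow>\<^sub>L 'a) \<le> norm c"
    by (simp add: mult_left_le)
  then show "norm (c + norm c *\<^sub>R id_blinfun) \<le> s + norm c"
    using norm_triangle_ineq[of c "norm c *\<^sub>R id_blinfun"] assms by simp
qed

lemma spectral_subspace_invariant:
  fixes y :: "'a::real_inner \<Rightarrow>\<^sub>L 'a"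
  assumes "symmetric_op c" and comm: "\<And>u. c (y u) = y (c u)" and "v \<in> spectral_subspace c s"
  shows "blinfun_apply y v \<in> spectral_subspace c s"
  using assms unfolding spectral_subspace_def
  by (intro growth_space_invariant shift_symmetric) (simp_all add: blinfun.bilinear_simps)

lemma spectral_subspace_upper:
  assumes "v \<in> spectral_subspace c s"
  shows "inner v (c v) \<le> s * (norm v)\<^sup>2"
  using growth_space_upper[OF assms[unfolded spectral_subspace_def]]
  by (simp add: blinfun.bilinear_simps inner_simps algebra_simps power2_norm_eq_inner)

lemma spectral_subspace_lower:
  fixes c :: "'a::{real_inner, banach} \<Rightarrow>\<^sub>L 'a"
  assumes "symmetric_op c" "\<And>z. z \<in> spectral_subspace c s \<Longrightarrow> inner v z = 0"
  shows "s * (norm v)\<^sup>2 \<le> inner v (c v)"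
  using growth_space_lower[OF shift_symmetric[OF assms(1)] shift_positive, of "s + norm c" v]
    assms(2)[unfolded spectral_subspace_def]
  by (simp add: blinfun.bilinear_simps inner_simps algebra_simps power2_norm_eq_inner)

text \<open>Invariance of the range under \<open>y\<close> gives \<open>p y p = y p\<close>; invariance under the adjoint \<open>y'\<close>
  gives \<open>p y = p y p\<close>.\<close>
lemma orth_projection_commute:
  fixes p y y' :: "'a::real_inner \<Rightarrow>\<^sub>L 'a"
  assumes p: "orth_projection p" and adj: "\<And>u v. inner (y' u) v = inner u (y v)"
    and inv: "\<And>v. p v = v \<Longrightarrow> p (y v) = y v" and inv': "\<And>v. p v = v \<Longrightarrow> p (y' v) = y' v"
  shows "p (blinfun_apply y v) = y (p v)"
proof -
  have "inner (p (y (v - p v))) u = 0" for u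
  proof -
    have "inner (p (y (v - p v))) u = inner (y (v - p v)) (p u)"
      using p by (simp add: orth_projection_def symmetric_op_def)
    also have "\<dots> = inner (v - p v) (y' (p u))" using adj by (metis inner_commute)
    also have "\<dots> = inner (v - p v) (p (y' (p u)))" using inv' p by (simp add: orth_projection_idem)
    also have "\<dots> = inner (p (v - p v)) (y' (p u))"
      using p by (simp add: orth_projection_def symmetric_op_def)
    also have "\<dots> = 0" using p by (simp add: blinfun.bilinear_simps orth_projection_idem)
    finally show ?thesis .
  qed
  then have "p (y (v - p v)) = 0" by (metis inner_eq_zero_iff)
  moreover have "p (y (p v)) = y (p v)" using inv p by (simp add: orth_projection_idem)
  ultimately show ?thesis by (simp add: blinfun.bilinear_simps)
qed

definition resolution :: "('a::{real_inner, banach} \<Rightarrow>\<^sub>L 'a) \<Rightarrow> real \<Rightarrow> ('a \<Rightarrow>\<^sub>L 'a)" where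
  "resolution c s = (SOME p. orth_projection p \<and> (\<forall>v. p v = v \<longleftrightarrow> v \<in> spectral_subspace c s))"

lemma resolution:
  assumes "symmetric_op c"
  shows "orth_projection (resolution c s)" "resolution c s v = v \<longleftrightarrow> v \<in> spectral_subspace c s"
proof -
  have "\<exists>p. orth_projection p \<and> (\<forall>v. p v = v \<longleftrightarrow> v \<in> spectral_subspace c s)"
    using projection_onto_subspace[OF subspace_spectral_subspace[OF assms] closed_spectral_subspace]
    by metis
  from someI_ex[OF this]
  show "orth_projection (resolution c s)" "resolution c s v = v \<longleftrightarrow> v \<in> spectral_subspace c s"
    unfolding resolution_def by blast+
qed

lemma resolution_commute:
  fixes y :: "'a::{real_inner, banach} \<Rightarrow>\<^sub>L 'a"
  assumes c: "symmetric_op c" and comm: "\<And>u. c (y u) = y (c u)"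
  shows "resolution c s (y v) = y (resolution c s v)"
proof -
  obtain y' where y': "\<And>u v. inner (blinfun_apply y' u) v = inner u (y v)"
    using real_adjoint_exists by blast
  have comm': "c (y' u) = y' (c u)" for u
  proof -
    have "inner (c (y' u)) v = inner (y' (c u)) v" for v
      using symmetric_opD[OF c] by (simp add: y' comm)
    then have "inner (c (y' u) - y' (c u)) (c (y' u) - y' (c u)) = 0" by (simp add: inner_diff_left)
    then show ?thesis by simp
  qed
  show ?thesis
    by (rule orth_projection_commute[OF resolution(1)[OF c] y'])
      (auto simp: resolution(2)[OF c] intro: spectral_subspace_invariant[OF c comm]
        spectral_subspace_invariant[OF c comm'])
qed

lemma resolution_mono:
  assumes "symmetric_op c" "s \<le> t"
  shows "resolution c t (resolution c s v) = resolution c s v"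
  using spectral_subspace_mono[OF assms] orth_projection_idem[OF resolution(1)[OF assms(1)]]
  by (simp add: resolution(2)[OF assms(1)]) (metis resolution(2)[OF assms(1)] subsetD)

lemma resolution_lower:
  assumes c: "symmetric_op c" and "resolution c s v = 0"
  shows "s * (norm v)\<^sup>2 \<le> inner v (c v)"
proof (rule spectral_subspace_lower[OF c])
  fix z assume "z \<in> spectral_subspace c s"
  then have "resolution c s z = z" by (simp add: resolution(2)[OF c])
  then show "inner v z = 0"
    using orth_projection_inner(1)[OF resolution(1)[OF c], of v s z] assms(2) by simp
qed

lemma resolution_upper:
  assumes c: "symmetric_op c" and "resolution c s v = v"
  shows "inner v (c v) \<le> s * (norm v)\<^sup>2"
  using assms by (simp add: resolution(2)[OF c] spectral_subspace_upper)

section \<open>Limits of projections\<close>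

text \<open>The squared norms of \<open>S n x\<close> increase and are bounded, and their differences are the squared
  norms of the differences of the vectors.\<close>
lemma increasing_projections_converge:
  fixes S :: "nat \<Rightarrow> 'a::{real_inner, banach} \<Rightarrow>\<^sub>L 'a"
  assumes S: "\<And>n. orth_projection (S n)" and inc: "\<And>n x. S (Suc n) (S n x) = S n x"
  obtains p where "orth_projection p" "\<And>x. (\<lambda>n. S n x) \<longlonglongrightarrow> p x"
proof -
  have le: "S m (S n x) = S n x" if "n \<le> m" for n m x
    using that by (induction m rule: dec_induct) (use S inc orth_projection_idem in \<open>metis+\<close>)
  have le': "S n (S m x) = S n x" if "n \<le> m" for n m x
  proof -
    have "inner (S n (S m x) - S n x) u = 0" for u
      using le[OF that, of u] S[of n] S[of m]
      by (simp add: orth_projection_def symmetric_op_def inner_diff_left)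
    then show ?thesis by (metis eq_iff_diff_eq_0 inner_eq_zero_iff)
  qed
  have diff: "(norm (S m x - S n x))\<^sup>2 = (norm (S m x))\<^sup>2 - (norm (S n x))\<^sup>2" if "n \<le> m" for n m x
    using orth_projection_pythagoras[OF S[of n], of "S m x"] le'[OF that, of x] by simp
  have conv: "convergent (\<lambda>n. S n x)" for x
  proof -
    have mono: "incseq (\<lambda>n. (norm (S n x))\<^sup>2)"
    proof (rule incseq_SucI)
      fix n show "(norm (S n x))\<^sup>2 \<le> (norm (S (Suc n) x))\<^sup>2"
        using diff[of n "Suc n" x] zero_le_power2[of "norm (S (Suc n) x - S n x)"] by linarith
    qed
    have "(norm (S n x))\<^sup>2 \<le> (norm x)\<^sup>2" for n
      by (simp add: power_mono orth_projection_norm_le[OF S])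
    then obtain L where "(\<lambda>n. (norm (S n x))\<^sup>2) \<longlonglongrightarrow> L"
      using incseq_convergent[OF mono] by blast
    then have cau: "Cauchy (\<lambda>n. (norm (S n x))\<^sup>2)" by (rule LIMSEQ_imp_Cauchy)
    have "Cauchy (\<lambda>n. S n x)"
    proof (rule CauchyI')
      fix e :: real assume "0 < e"
      then obtain N where N: "\<And>m n. m \<ge> N \<Longrightarrow> n \<ge> N \<Longrightarrow> norm ((norm (S m x))\<^sup>2 - (norm (S n x))\<^sup>2) < e\<^sup>2"
        using CauchyD[OF cau, of "e\<^sup>2"] by auto
      show "\<exists>N. \<forall>m\<ge>N. \<forall>n>m. dist (S m x) (S n x) < e"
      proof (intro exI[of _ N] allI impI)
        fix m n assume "N \<le> m" "m < n"
        then have "(norm (S n x - S m x))\<^sup>2 < e\<^sup>2" using diff[of m n x] N[of n m] by simp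
        then show "dist (S m x) (S n x) < e"
          using \<open>0 < e\<close> power2_less_imp_less[of "norm (S n x - S m x)" e]
          by (simp add: dist_norm norm_minus_commute)
      qed
    qed
    then show ?thesis by (simp add: Cauchy_convergent_iff)
  qed
  define f where "f x = lim (\<lambda>n. S n x)" for x
  have f: "(\<lambda>n. S n x) \<longlonglongrightarrow> f x" for x using conv by (simp add: f_def convergent_LIMSEQ_iff)
  have "bounded_linear f"
  proof (rule bounded_linear_intro)
    show "f (x + y) = f x + f y" for x y
      using tendsto_add[OF f[of x] f[of y]] f[of "x + y"]
      by (simp add: blinfun.bilinear_simps LIMSEQ_unique)
    show "f (r *\<^sub>R x) = r *\<^sub>R f x" for r x
      using tendsto_scaleR[OF tendsto_const f[of x], of r] f[of "r *\<^sub>R x"]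
      by (simp add: blinfun.bilinear_simps LIMSEQ_unique)
    show "norm (f x) \<le> norm x * 1" for x
      using LIMSEQ_le_const2[OF tendsto_norm[OF f[of x]]] orth_projection_norm_le[OF S] by auto
  qed
  then have app: "blinfun_apply (Blinfun f) = f" by (rule bounded_linear_Blinfun_apply)
  show thesis
  proof (rule that)
    have sym: "inner (f x) y = inner x (f y)" for x y
    proof -
      have "(\<lambda>n. inner (S n x) y) \<longlonglongrightarrow> inner (f x) y" "(\<lambda>n. inner x (S n y)) \<longlonglongrightarrow> inner x (f y)"
        by (intro tendsto_intros f)+
      then show ?thesis
        using S by (simp add: orth_projection_def symmetric_op_def LIMSEQ_unique)
    qed
    have fixS: "f (S n x) = S n x" for n x
    proof (rule LIMSEQ_unique[OF f])
      show "(\<lambda>m. S m (S n x)) \<longlonglongrightarrow> S n x"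
        by (rule tendsto_eventually) (auto simp: eventually_sequentially le intro!: exI[of _ n])
    qed
    have "f (f x) = f x" for x
    proof -
      have "(\<lambda>n. blinfun_apply (Blinfun f) (S n x)) \<longlonglongrightarrow> Blinfun f (f x)" by (intro tendsto_intros f)
      then have "(\<lambda>n. S n x) \<longlonglongrightarrow> f (f x)" by (simp add: app fixS)
      then show ?thesis using f LIMSEQ_unique by blast
    qed
    then show "orth_projection (Blinfun f)"
      using sym by (simp add: orth_projection_def symmetric_op_def app)
    show "(\<lambda>n. S n x) \<longlonglongrightarrow> Blinfun f x" for x using f by (simp add: app)
  qed
qed

lemma orthogonal_projections_sum:
  fixes p :: "nat \<Rightarrow> 'a::{real_inner, banach} \<Rightarrow>\<^sub>L 'a"
  assumes p: "\<And>n. orth_projection (p n)" and orth: "\<And>m n x. m \<noteq> n \<Longrightarrow> p m (p n x) = 0"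
  obtains q where "orth_projection q" "\<And>x. (\<lambda>n. p n x) sums q x"
proof -
  define S where "S n = (\<Sum>k<n. p k)" for n
  have app: "S n x = (\<Sum>k<n. p k x)" for n x by (simp add: S_def blinfun.sum_left)
  have pS: "p m (S n x) = (if m < n then p m x else 0)" for m n x
  proof -
    have "p m (S n x) = (\<Sum>k<n. if k = m then p m x else 0)"
      unfolding app blinfun.sum_right
      by (intro sum.cong refl) (auto simp: orth orth_projection_idem[OF p])
    also have "\<dots> = (if m < n then p m x else 0)" by simp
    finally show ?thesis .
  qed
  have S: "orth_projection (S n)" for n
    unfolding orth_projection_def symmetric_op_def
  proof (intro conjI allI)
    show "inner (S n x) y = inner x (S n y)" for x y
      using p by (simp add: app inner_sum_left inner_sum_right orth_projection_def symmetric_op_def)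
    show "S n (S n x) = S n x" for x
    proof -
      have "S n (S n x) = (\<Sum>k<n. p k (S n x))" by (rule app)
      also have "\<dots> = S n x" unfolding pS by (simp add: app)
      finally show ?thesis .
    qed
  qed
  have "S (Suc n) (S n x) = S n x" for n x
  proof -
    have "S (Suc n) (S n x) = (\<Sum>k<Suc n. p k (S n x))" by (rule app)
    also have "\<dots> = S n x" unfolding pS by (simp add: app)
    finally show ?thesis .
  qed
  then obtain q where q: "orth_projection q" "\<And>x. (\<lambda>n. S n x) \<longlonglongrightarrow> q x"
    using increasing_projections_converge[of S, OF S] by metis
  show thesis by (rule that[OF q(1)]) (use q(2) in \<open>simp add: sums_def app\<close>)
qed

lemma symmetric_op_eqI:
  assumes "symmetric_op p" "symmetric_op q" "\<And>x. inner x (p x) = inner x (q x)"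
  shows "p = q"
proof (rule blinfun_eqI)
  fix x
  have "inner (p x - q x) y = 0" for y
  proof -
    have "inner (x + y) (p (x + y)) = inner (x + y) (q (x + y))" by (rule assms)
    then have "inner x (p y) + inner y (p x) = inner x (q y) + inner y (q x)"
      using assms(3)[of x] assms(3)[of y] by (simp add: blinfun.bilinear_simps inner_simps)
    then show ?thesis
      using symmetric_opD[OF assms(1), of x y] symmetric_opD[OF assms(2), of x y]
      by (simp add: inner_simps inner_commute)
  qed
  then show "p x = q x" by (metis eq_iff_diff_eq_0 inner_eq_zero_iff)
qed

section \<open>Bounded operators on a complex Hilbert space\<close>

text \<open>The complex inner product is determined by its real part; this allows all arguments about
  adjoints to be carried out with the real inner product.\<close>
lemma Im_cinner: "Im (cinner x y) = - inner x (\<i> *\<^sub>C y)" for x y :: "'h::chilbert_space"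
  by (simp add: cinner_scaleC_right flip: Re_cinner)

lemma bounded_opsD: "x \<in> bounded_ops \<Longrightarrow> blinfun_apply x (c *\<^sub>C \<xi>) = c *\<^sub>C blinfun_apply x \<xi>"
  by (simp add: bounded_ops_def)

lemma cinner_adjoint:
  fixes x y :: "'h::chilbert_space \<Rightarrow>\<^sub>L 'h"
  assumes x: "x \<in> bounded_ops" and adj: "\<And>\<xi> \<eta>. inner (y \<xi>) \<eta> = inner \<xi> (x \<eta>)"
  shows "cinner (y \<xi>) \<eta> = cinner \<xi> (x \<eta>)"
  by (rule complex_eqI) (simp_all add: Re_cinner Im_cinner adj bounded_opsD[OF x])

lemma adj_eqI:
  fixes x y :: "'h::chilbert_space \<Rightarrow>\<^sub>L 'h"
  assumes x: "x \<in> bounded_ops" and adj: "\<And>\<xi> \<eta>. inner (y \<xi>) \<eta> = inner \<xi> (x \<eta>)"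
  shows "adj x = y"
  unfolding adj_def
proof (rule the_equality)
  show "\<forall>\<xi> \<eta>. cinner (y \<xi>) \<eta> = cinner \<xi> (x \<eta>)" using cinner_adjoint[OF assms] by blast
  fix z :: "'h \<Rightarrow>\<^sub>L 'h"
  assume z: "\<forall>\<xi> \<eta>. cinner (z \<xi>) \<eta> = cinner \<xi> (x \<eta>)"
  show "z = y"
  proof (rule blinfun_eqI)
    fix \<xi>
    have "inner (z \<xi>) \<eta> = inner (y \<xi>) \<eta>" for \<eta>
      using z by (metis Re_cinner adj)
    then have "inner (z \<xi> - y \<xi>) (z \<xi> - y \<xi>) = 0" by (simp add: inner_diff_left)
    then show "z \<xi> = y \<xi>" by simp
  qed
qed

lemma inner_adj:
  fixes x :: "'h::chilbert_space \<Rightarrow>\<^sub>L 'h"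
  assumes "x \<in> bounded_ops"
  shows "inner (adj x \<xi>) \<eta> = inner \<xi> (x \<eta>)"
proof -
  obtain y :: "'h \<Rightarrow>\<^sub>L 'h" where y: "\<And>\<xi> \<eta>. inner (y \<xi>) \<eta> = inner \<xi> (x \<eta>)"
    using real_adjoint_exists by blast
  then show ?thesis using adj_eqI[OF assms y] by simp
qed

text \<open>For complex-linear operators, self-adjointness can be tested with the real inner product.\<close>
lemma adj_self_iff: "x \<in> bounded_ops \<Longrightarrow> adj x = x \<longleftrightarrow> symmetric_op x"
  by (metis adj_eqI inner_adj symmetric_op_def)

lemma projection_op_iff: "projection_op p \<longleftrightarrow> p \<in> bounded_ops \<and> orth_projection p"
  unfolding projection_op_def orth_projection_def
  by (metis adj_self_iff blinfun_apply_blinfun_compose blinfun_eqI)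

lemma cinner_symmetric:
  fixes x :: "'h::chilbert_space \<Rightarrow>\<^sub>L 'h"
  assumes "x \<in> bounded_ops" "symmetric_op x"
  shows "cinner \<xi> (x \<xi>) = complex_of_real (inner \<xi> (x \<xi>))"
proof (rule complex_eqI)
  have "cinner \<xi> (x \<xi>) = cnj (cinner \<xi> (x \<xi>))"
    using cinner_adjoint[OF assms(1), of x \<xi> \<xi>] symmetric_opD[OF assms(2)]
    by (metis cinner_commute)
  then have "Im (cinner \<xi> (x \<xi>)) = - Im (cinner \<xi> (x \<xi>))" by (metis cnj.sel(2))
  then show "Im (cinner \<xi> (x \<xi>)) = Im (complex_of_real (inner \<xi> (x \<xi>)))" by simp
qed (simp add: Re_cinner)

lemma positive_opI:
  fixes x :: "'h::chilbert_space \<Rightarrow>\<^sub>L 'h"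
  assumes "x \<in> bounded_ops" "symmetric_op x" "\<And>\<xi>. 0 \<le> inner \<xi> (x \<xi>)"
  shows "positive_op x"
  using assms by (simp add: positive_op_def cinner_symmetric)

lemma positive_opD: "positive_op x \<Longrightarrow> 0 \<le> inner \<xi> (x \<xi>)"
  unfolding positive_op_def by (metis Re_cinner complex_nonneg_Reals_iff)

lemma bounded_ops_closed:
  "x \<in> bounded_ops \<Longrightarrow> y \<in> bounded_ops \<Longrightarrow> x + y \<in> bounded_ops"
  "x \<in> bounded_ops \<Longrightarrow> y \<in> bounded_ops \<Longrightarrow> x - y \<in> bounded_ops"
  "x \<in> bounded_ops \<Longrightarrow> y \<in> bounded_ops \<Longrightarrow> x o\<^sub>L y \<in> bounded_ops"
  "id_blinfun \<in> bounded_ops"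
proof -
  have "c *\<^sub>C (u - v) = c *\<^sub>C u - c *\<^sub>C v" for c and u v :: 'a
    by (metis add_diff_cancel_right' diff_add_cancel scaleC_add_right)
  then show "x \<in> bounded_ops \<Longrightarrow> y \<in> bounded_ops \<Longrightarrow> x + y \<in> bounded_ops"
    "x \<in> bounded_ops \<Longrightarrow> y \<in> bounded_ops \<Longrightarrow> x - y \<in> bounded_ops"
    "x \<in> bounded_ops \<Longrightarrow> y \<in> bounded_ops \<Longrightarrow> x o\<^sub>L y \<in> bounded_ops"
    "id_blinfun \<in> bounded_ops" for x y :: "'a \<Rightarrow>\<^sub>L 'a"
    by (simp_all add: bounded_ops_def blinfun.bilinear_simps scaleC_add_right)
qed

section \<open>Projection-valued measures\<close>

text \<open>The part of the notion of a spectral measure that does not refer to the operator,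
  with orthogonality in the real sense.\<close>
locale projection_measure =
  fixes P :: "real set \<Rightarrow> ('h::chilbert_space \<Rightarrow>\<^sub>L 'h)"
  assumes proj: "E \<in> sets borel \<Longrightarrow> orth_projection (P E)"
    and P_UNIV: "P UNIV = id_blinfun"
    and P_Int: "E \<in> sets borel \<Longrightarrow> F \<in> sets borel \<Longrightarrow> P (E \<inter> F) = P E o\<^sub>L P F"
    and P_sums: "\<And>A \<xi>. range A \<subseteq> sets borel \<Longrightarrow> disjoint_family A \<Longrightarrow>
      (\<lambda>n. P (A n) \<xi>) sums P (\<Union>n::nat. A n) \<xi>"
    and P_compact: "\<exists>K. P {-K..K} = id_blinfun"
begin

lemma P_empty: "P {} = 0"
proof (rule blinfun_eqI)
  fix \<xi>
  have "(\<lambda>n. P {} \<xi>) sums P (\<Union>n::nat. {}) \<xi>" by (rule P_sums) (auto simp: disjoint_family_on_def)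
  then have "(\<lambda>n. P {} \<xi>) \<longlonglongrightarrow> 0" using sums_summable summable_LIMSEQ_zero by blast
  then show "P {} \<xi> = blinfun_apply 0 \<xi>" by (simp add: LIMSEQ_const_iff blinfun.zero_left)
qed

lemma P_disjoint_Un:
  assumes "E \<in> sets borel" "F \<in> sets borel" "E \<inter> F = {}"
  shows "P (E \<union> F) = P E + P F"
proof (rule blinfun_eqI)
  fix \<xi>
  have "(\<lambda>n. P (binaryset E F n) \<xi>) sums P (\<Union>n. binaryset E F n) \<xi>"
    using assms by (intro P_sums) (auto simp: disjoint_family_on_def binaryset_def)
  moreover have "(\<lambda>n. P (binaryset E F n) \<xi>) sums (P E \<xi> + P F \<xi>)"
    using binaryset_sums[of "\<lambda>A. P A \<xi>" E F] by (simp add: P_empty blinfun.zero_left)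
  ultimately show "P (E \<union> F) \<xi> = (P E + P F) \<xi>"
    using sums_unique2 by (metis UN_binaryset_eq plus_blinfun.rep_eq)
qed

lemma P_Compl: "E \<in> sets borel \<Longrightarrow> P (- E) \<xi> = \<xi> - P E \<xi>"
  using P_disjoint_Un[of E "- E"] P_UNIV
  by (simp add: Compl_partition eq_diff_eq add.commute)
     (metis add.commute blinfun_apply_id_blinfun plus_blinfun.rep_eq)

lemma P_greaterThan: "P {s<..} \<xi> = \<xi> - P {..s} \<xi>"
  using P_Compl[of "{..s}"] by (simp add: Compl_atMost)

lemma P_apply_P: "E \<in> sets borel \<Longrightarrow> F \<in> sets borel \<Longrightarrow> P E (P F \<xi>) = P (E \<inter> F) \<xi>"
  by (simp add: P_Int)

lemma P_form: "E \<in> sets borel \<Longrightarrow> Re (cinner \<xi> (P E \<xi>)) = (norm (P E \<xi>))\<^sup>2"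
  by (simp add: Re_cinner orth_projection_form proj)

lemma sets_vector_measure [simp, measurable_cong]: "sets (vector_measure P \<xi>) = sets borel"
  unfolding vector_measure_def by (simp add: sets.sigma_sets_eq[of borel, simplified])

lemma space_vector_measure [simp]: "space (vector_measure P \<xi>) = UNIV"
  unfolding vector_measure_def by (simp add: space_measure_of_conv)

lemma emeasure_vector_measure:
  assumes "E \<in> sets borel"
  shows "emeasure (vector_measure P \<xi>) E = ennreal ((norm (P E \<xi>))\<^sup>2)"
proof -
  let ?\<mu> = "\<lambda>E. ennreal (Re (cinner \<xi> (P E \<xi>)))"
  have "emeasure (vector_measure P \<xi>) E = ?\<mu> E"
    unfolding vector_measure_def
  proof (rule emeasure_measure_of_sigma)
    show "sigma_algebra UNIV (sets borel :: real set set)"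
      using sets.sigma_algebra_axioms[of "borel :: real measure"] by simp
    show "positive (sets borel) ?\<mu>" using P_form[of "{}" \<xi>] by (simp add: positive_def P_empty blinfun.zero_left)
    show "countably_additive (sets borel) ?\<mu>"
    proof (rule countably_additiveI)
      fix A :: "nat \<Rightarrow> real set"
      assume A: "range A \<subseteq> sets borel" "disjoint_family A"
      have "(\<lambda>n. inner \<xi> (P (A n) \<xi>)) sums inner \<xi> (P (\<Union>n. A n) \<xi>)"
        by (rule bounded_linear.sums[OF bounded_linear_inner_right P_sums[OF A]])
      then show "(\<Sum>n. ?\<mu> (A n)) = ?\<mu> (\<Union>n. A n)"
        using A(1) by (intro suminf_ennreal_eq) (auto simp: P_form simp flip: Re_cinner)
    qed
  qed fact
  then show ?thesis using assms by (simp add: P_form)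
qed

lemma finite_vector_measure: "finite_measure (vector_measure P \<xi>)"
  by (rule finite_measureI) (simp add: emeasure_vector_measure)

lemma measure_vector_measure_UNIV: "measure (vector_measure P \<xi>) UNIV = (norm \<xi>)\<^sup>2"
  by (simp add: measure_def emeasure_vector_measure P_UNIV)

lemma AE_vector_measure:
  assumes "E \<in> sets borel" "P E \<xi> = \<xi>"
  shows "AE t in vector_measure P \<xi>. t \<in> E"
proof (rule AE_I')
  show "- E \<in> null_sets (vector_measure P \<xi>)"
    using assms by (auto simp: null_sets_def emeasure_vector_measure P_Compl)
qed auto

lemma integrable_vector_measure: "integrable (vector_measure P \<xi>) (\<lambda>t. t)"
proof -
  obtain K where K: "P {-K..K} = id_blinfun" using P_compact by blast
  have "AE t in vector_measure P \<xi>. norm t \<le> K"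
    using AE_vector_measure[of "{-K..K}" \<xi>] by (rule AE_mp) (auto simp: K)
  then show ?thesis
    by (intro finite_measure.integrable_const_bound[OF finite_vector_measure]) auto
qed

text \<open>The quadratic form, at \<open>\<xi>\<close>, of the operator that is the weak integral of the identity.\<close>
definition mean :: "'h \<Rightarrow> real" where
  "mean \<xi> = (\<integral>t. t \<partial>vector_measure P \<xi>)"

lemma vector_measure_restrict:
  assumes "E \<in> sets borel"
  shows "vector_measure P (P E \<xi>) = density (vector_measure P \<xi>) (indicator E)"
proof (rule measure_eqI)
  fix F assume "F \<in> sets (vector_measure P (P E \<xi>))"
  then have F: "F \<in> sets borel" by simp
  have "emeasure (density (vector_measure P \<xi>) (indicator E)) F = emeasure (vector_measure P \<xi>) (E \<inter> F)"
    using assms F by (subst emeasure_density) (auto simp flip: indicator_inter_arith)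
  then show "emeasure (vector_measure P (P E \<xi>)) F = emeasure (density (vector_measure P \<xi>) (indicator E)) F"
    using assms F by (simp add: emeasure_vector_measure P_apply_P Int_commute)
qed simp

lemma mean_restrict:
  assumes "E \<in> sets borel"
  shows "mean (P E \<xi>) = (\<integral>t. indicator E t * t \<partial>vector_measure P \<xi>)"
proof -
  have "mean (P E \<xi>) = (\<integral>t. t \<partial>density (vector_measure P \<xi>) (\<lambda>t. ennreal (indicator E t)))"
    by (simp add: mean_def vector_measure_restrict[OF assms] ennreal_indicator)
  also have "\<dots> = (\<integral>t. indicator E t *\<^sub>R t \<partial>vector_measure P \<xi>)"
    using assms by (intro integral_density) auto
  finally show ?thesis by simp
qed

text \<open>The scalar measure of \<open>\<xi>\<close> is the sum of those of its components in the ranges of \<open>P E\<close> and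
  \<open>P (- E)\<close>, since the cross terms vanish.\<close>
lemma mean_split:
  assumes "E \<in> sets borel"
  shows "mean \<xi> = mean (P E \<xi>) + mean (\<xi> - P E \<xi>)"
proof -
  have int: "integrable (vector_measure P \<xi>) (\<lambda>t. indicator F t * t)" if "F \<in> sets borel" for F
    using integrable_mult_indicator[OF _ integrable_vector_measure, of F] that by simp
  have "mean (P E \<xi>) + mean (\<xi> - P E \<xi>)
      = (\<integral>t. indicator E t * t \<partial>vector_measure P \<xi>) + (\<integral>t. indicator (- E) t * t \<partial>vector_measure P \<xi>)"
    using mean_restrict[of E \<xi>] mean_restrict[of "- E" \<xi>] assms by (simp add: P_Compl)
  also have "\<dots> = (\<integral>t. indicator E t * t + indicator (- E) t * t \<partial>vector_measure P \<xi>)"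
    using assms int by (intro Bochner_Integration.integral_add[symmetric]) auto
  also have "\<dots> = mean \<xi>"
    unfolding mean_def by (intro Bochner_Integration.integral_cong) (auto simp: indicator_def)
  finally show ?thesis by simp
qed

lemma mean_upper:
  assumes "E \<in> sets borel" "P E \<xi> = \<xi>" "\<And>t. t \<in> E \<Longrightarrow> t \<le> s"
  shows "mean \<xi> \<le> s * (norm \<xi>)\<^sup>2"
proof -
  interpret finite_measure "vector_measure P \<xi>" by (rule finite_vector_measure)
  have "mean \<xi> \<le> (\<integral>t. s \<partial>vector_measure P \<xi>)"
    unfolding mean_def using AE_vector_measure[OF assms(1,2)] assms(3)
    by (intro integral_mono_AE integrable_vector_measure) auto
  then show ?thesis by (simp add: measure_vector_measure_UNIV mult.commute)
qed

lemma mean_lower: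
  assumes "E \<in> sets borel" "P E \<xi> = \<xi>" "\<And>t. t \<in> E \<Longrightarrow> s \<le> t"
  shows "s * (norm \<xi>)\<^sup>2 \<le> mean \<xi>"
proof -
  interpret finite_measure "vector_measure P \<xi>" by (rule finite_vector_measure)
  have "(\<integral>t. s \<partial>vector_measure P \<xi>) \<le> mean \<xi>"
    unfolding mean_def using AE_vector_measure[OF assms(1,2)] assms(3)
    by (intro integral_mono_AE integrable_vector_measure) auto
  then show ?thesis by (simp add: measure_vector_measure_UNIV mult.commute)
qed

text \<open>On \<open>(-\<infinity>, s)\<close> the function \<open>s - t\<close> is strictly positive, so its integral vanishes only for the
  zero measure.\<close>
lemma mean_less:
  assumes \<xi>: "P {..<s} \<xi> = \<xi>" and ge: "s * (norm \<xi>)\<^sup>2 \<le> mean \<xi>"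
  shows "\<xi> = 0"
proof -
  interpret finite_measure "vector_measure P \<xi>" by (rule finite_vector_measure)
  have AE: "AE t in vector_measure P \<xi>. t < s" using AE_vector_measure[OF _ \<xi>] by simp
  have int: "integrable (vector_measure P \<xi>) (\<lambda>t. s - t)"
    by (intro Bochner_Integration.integrable_diff integrable_vector_measure) simp
  have "(\<integral>t. s - t \<partial>vector_measure P \<xi>) = s * (norm \<xi>)\<^sup>2 - mean \<xi>"
    unfolding mean_def
    by (simp add: integrable_vector_measure measure_vector_measure_UNIV)
  also have "\<dots> \<le> 0" using ge by simp
  finally have le: "(\<integral>t. s - t \<partial>vector_measure P \<xi>) \<le> 0" .
  have nonneg: "AE t in vector_measure P \<xi>. 0 \<le> s - t" using AE by eventually_elim simp
  have "(\<integral>t. s - t \<partial>vector_measure P \<xi>) = 0"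
    using le integral_nonneg_AE[OF nonneg] by (rule order_antisym)
  then have "AE t in vector_measure P \<xi>. s - t = 0"
    using integral_nonneg_eq_0_iff_AE[OF int nonneg] by blast
  with AE have "AE t in vector_measure P \<xi>. False" by eventually_elim simp
  then have "emeasure (vector_measure P \<xi>) UNIV = 0"
    using AE_iff_measurable[of UNIV "vector_measure P \<xi>" "\<lambda>_. False"] by simp
  then show ?thesis by (simp add: emeasure_vector_measure P_UNIV ennreal_eq_0_iff)
qed

lemma P_right_continuous:
  assumes "\<And>t. s < t \<Longrightarrow> P {..t} \<xi> = \<xi>"
  shows "P {..s} \<xi> = \<xi>"
proof -
  have "{s + inverse (real (Suc n))<..} \<in> null_sets (vector_measure P \<xi>)" for n
  proof -
    have "P {s + inverse (real (Suc n))<..} \<xi> = 0"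
      using assms[of "s + inverse (real (Suc n))"] by (simp add: P_greaterThan del: of_nat_Suc)
    then show ?thesis
      by (simp add: null_sets_def emeasure_vector_measure del: of_nat_Suc)
  qed
  then have "(\<Union>n. {s + inverse (real (Suc n))<..}) \<in> null_sets (vector_measure P \<xi>)" by auto
  also have "(\<Union>n. {s + inverse (real (Suc n))<..}) = {s<..}"
  proof (intro equalityI subsetI)
    fix t assume "t \<in> {s<..}"
    then obtain n where "inverse (real (Suc n)) < t - s" using reals_Archimedean[of "t - s"] by auto
    then show "t \<in> (\<Union>n. {s + inverse (real (Suc n))<..})" by (auto simp: algebra_simps)
  qed (auto intro: less_trans[rotated])
  finally show ?thesis by (auto simp: null_sets_def emeasure_vector_measure P_greaterThan)
qed

text \<open>On the range of \<open>P {a<..b}\<close> the two sides differ by at most \<open>(b - a) * (norm v)\<^sup>2\<close>. Both sides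
  are additive over the components of \<open>v\<close> in two half-intervals, so repeated bisection halves this
  bound each time.\<close>
lemma mean_eq_form:
  fixes c :: "'h \<Rightarrow>\<^sub>L 'h"
  assumes comm: "\<And>s v. P {..s} (c v) = c (P {..s} v)" and sym: "symmetric_op c"
    and upper: "\<And>s v. P {..s} v = v \<Longrightarrow> inner v (c v) \<le> s * (norm v)\<^sup>2"
    and lower: "\<And>s v. P {..s} v = 0 \<Longrightarrow> s * (norm v)\<^sup>2 \<le> inner v (c v)"
  shows "inner \<xi> (c \<xi>) = mean \<xi>"
proof -
  have approx: "\<bar>inner v (c v) - mean v\<bar> \<le> (b - a) / 2 ^ n * (norm v)\<^sup>2"
    if "a \<le> b" "P {a<..b} v = v" for a b v n
    using that
  proof (induction n arbitrary: a b v)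
    case 0
    have "P {..b} v = v" using P_apply_P[of "{..b}" "{a<..b}" v] 0 by (simp add: Int_absorb1 subset_eq)
    moreover have "P {..a} v = 0"
    proof -
      have "{..a} \<inter> {a<..b} = {}" by auto
      then show ?thesis using P_apply_P[of "{..a}" "{a<..b}" v] 0 by (simp add: P_empty blinfun.zero_left)
    qed
    ultimately show ?case
      using upper[of b v] lower[of a v] mean_upper[of "{a<..b}" v b] mean_lower[of "{a<..b}" v a] 0
      by (auto simp: abs_le_iff algebra_simps)
  next
    case (Suc n)
    define m where "m = (a + b) / 2"
    have m: "a \<le> m" "m \<le> b" "m - a = (b - a) / 2" "b - m = (b - a) / 2"
      using Suc.prems by (auto simp: m_def field_simps)
    define u w where "u = P {..m} v" and "w = v - u"
    have sub: "{a<..m} \<inter> ({..m} \<inter> {a<..b}) = {..m} \<inter> {a<..b}"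
      "{m<..b} \<inter> ({m<..} \<inter> {a<..b}) = {m<..} \<inter> {a<..b}"
      using m by auto
    have u: "P {a<..m} u = u"
    proof -
      have "u = P ({..m} \<inter> {a<..b}) v" using P_apply_P[of "{..m}" "{a<..b}" v] Suc.prems by (simp add: u_def)
      then show ?thesis using P_apply_P[of "{a<..m}" "{..m} \<inter> {a<..b}" v] by (simp add: sub)
    qed
    have w: "P {m<..b} w = w"
    proof -
      have "w = P ({m<..} \<inter> {a<..b}) v"
        using P_apply_P[of "{m<..}" "{a<..b}" v] Suc.prems by (simp add: u_def w_def P_greaterThan)
      then show ?thesis using P_apply_P[of "{m<..b}" "{m<..} \<inter> {a<..b}" v] by (simp add: sub)
    qed
    have Pw: "P {..m} w = 0"
      by (simp add: w_def u_def blinfun.bilinear_simps P_apply_P)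
    \<comment> \<open>The cross terms vanish because \<open>c\<close> commutes with \<open>P {..m}\<close>.\<close>
    have cross: "inner u (c w) = 0"
    proof -
      have "inner u (c w) = inner v (P {..m} (c w))"
        using proj[of "{..m}"] by (simp add: u_def orth_projection_def symmetric_op_def)
      then show ?thesis by (simp add: comm Pw blinfun.zero_right)
    qed
    have "inner v (c v) = inner u (c u) + inner w (c w)"
    proof -
      have "v = u + w" by (simp add: w_def)
      then show ?thesis
        using cross symmetric_opD[OF sym, of w u]
        by (simp add: blinfun.bilinear_simps inner_simps inner_commute)
    qed
    moreover have "mean v = mean u + mean w"
      unfolding w_def u_def by (rule mean_split) simp
    ultimately have "\<bar>inner v (c v) - mean v\<bar>
        \<le> (m - a) / 2 ^ n * (norm u)\<^sup>2 + (b - m) / 2 ^ n * (norm w)\<^sup>2"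
      using Suc.IH[OF m(1) u] Suc.IH[OF m(2) w] by linarith
    also have "\<dots> = (b - a) / 2 ^ Suc n * ((norm u)\<^sup>2 + (norm w)\<^sup>2)"
      by (simp only: m) (simp add: field_simps)
    also have "(norm u)\<^sup>2 + (norm w)\<^sup>2 = (norm v)\<^sup>2"
      using orth_projection_pythagoras[OF proj, of "{..m}" v] by (simp add: u_def w_def)
    finally show ?case .
  qed
  obtain K where K: "P {-K..K} = id_blinfun" using P_compact by blast
  have "P {- \<bar>K\<bar> - 1<..\<bar>K\<bar>} \<xi> = P ({- \<bar>K\<bar> - 1<..\<bar>K\<bar>} \<inter> {-K..K}) \<xi>"
    using P_apply_P[of "{- \<bar>K\<bar> - 1<..\<bar>K\<bar>}" "{-K..K}" \<xi>] by (simp add: K)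
  also have "{- \<bar>K\<bar> - 1<..\<bar>K\<bar>} \<inter> {-K..K} = {-K..K}" by auto
  finally have full: "P {- \<bar>K\<bar> - 1<..\<bar>K\<bar>} \<xi> = \<xi>" by (simp add: K)
  \<comment> \<open>Start the bisection from a half-open interval containing the compact support.\<close>
  define L where "L = 2 * \<bar>K\<bar> + 1"
  have bound: "\<bar>inner \<xi> (c \<xi>) - mean \<xi>\<bar> \<le> L * (norm \<xi>)\<^sup>2 * (1/2) ^ n" for n
    using approx[OF _ full, of n] by (simp add: L_def power_one_over algebra_simps divide_simps)
  have "(\<lambda>n. L * (norm \<xi>)\<^sup>2 * (1/2) ^ n) \<longlonglongrightarrow> L * (norm \<xi>)\<^sup>2 * 0"
    by (intro tendsto_intros LIMSEQ_power_zero) simp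
  then have "\<bar>inner \<xi> (c \<xi>) - mean \<xi>\<bar> \<le> 0"
    using bound by (intro LIMSEQ_le_const) auto
  then show ?thesis by simp
qed

text \<open>Comparing the forms at \<open>u + w\<close>, with \<open>u\<close> in the range of \<open>P E\<close> and \<open>w\<close> orthogonal to it, shows
  \<open>inner u (c w) = 0\<close>, by \<open>mean_split\<close>.\<close>
lemma form_commute:
  fixes c :: "'h \<Rightarrow>\<^sub>L 'h"
  assumes sym: "symmetric_op c" and form: "\<And>\<xi>. inner \<xi> (c \<xi>) = mean \<xi>" and E: "E \<in> sets borel"
  shows "P E (c v) = c (P E v)"
proof -
  have cross: "inner (P E x) (c (y - P E y)) = 0" for x y
  proof -
    define u w where "u = P E x" and "w = y - P E y"
    have P: "P E (u + w) = u" using E by (simp add: u_def w_def blinfun.bilinear_simps P_apply_P)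
    have "mean (u + w) = mean u + mean w"
      using mean_split[OF E, of "u + w"] by (simp add: P)
    then have "inner u (c w) + inner w (c u) = 0"
      by (simp flip: form add: blinfun.bilinear_simps inner_simps)
    then show ?thesis
      using symmetric_opD[OF sym, of u w] by (simp add: u_def w_def inner_commute)
  qed
  have "inner (P E (c v) - c (P E v)) z = 0" for z
  proof -
    have "inner (c (P E v)) (z - P E z) = 0"
      using cross[of v z] symmetric_opD[OF sym] by simp
    moreover have "inner (P E z) (c v) = inner (P E z) (c (P E v))"
      using cross[of z v] by (simp add: blinfun.bilinear_simps inner_simps)
    moreover have "inner (P E (c v)) z = inner (P E z) (c v)"
      using proj[OF E] by (simp add: orth_projection_def symmetric_op_def inner_commute)
    ultimately show ?thesis by (simp add: inner_simps inner_commute)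
  qed
  then have "inner (P E (c v) - c (P E v)) (P E (c v) - c (P E v)) = 0" by blast
  then show ?thesis by simp
qed

end

text \<open>A common vector \<open>w\<close> of the range of \<open>p\<close> and the kernel of \<open>q\<close> satisfies
  \<open>t * (norm w)\<^sup>2 \<le> inner w (c w) \<le> s * (norm w)\<^sup>2\<close>.\<close>
lemma projection_order_from_form:
  fixes p q c :: "'a::real_inner \<Rightarrow>\<^sub>L 'a"
  assumes p: "orth_projection p" and q: "orth_projection q"
    and comm: "\<And>v. p (q v) = q (p v)"
    and upper: "\<And>v. p v = v \<Longrightarrow> inner v (c v) \<le> s * (norm v)\<^sup>2"
    and lower: "\<And>v. q v = 0 \<Longrightarrow> t * (norm v)\<^sup>2 \<le> inner v (c v)"
    and "s < t" and v: "p v = v"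
  shows "q v = v"
proof -
  define w where "w = v - q v"
  have "p w = w" using comm[of v] v by (simp add: w_def blinfun.bilinear_simps)
  moreover have "q w = 0" using q by (simp add: w_def blinfun.bilinear_simps orth_projection_idem)
  ultimately have "t * (norm w)\<^sup>2 \<le> s * (norm w)\<^sup>2" using upper lower order_trans by blast
  then have "w = 0" using \<open>s < t\<close> by (simp add: mult_le_cancel_right)
  then show ?thesis by (simp add: w_def)
qed

lemma orth_projection_eqI:
  fixes p q :: "'a::real_inner \<Rightarrow>\<^sub>L 'a"
  assumes p: "orth_projection p" and q: "orth_projection q" and "\<And>v. p v = v \<longleftrightarrow> q v = v"
  shows "p = q"
proof (rule symmetric_op_eqI)
  show "symmetric_op p" "symmetric_op q" using p q by (auto simp: orth_projection_def)
  fix x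
  have "p (q x) = q x" using assms(3)[of "q x"] orth_projection_idem[OF q] by blast
  moreover have "q (p x) = p x" using assms(3)[of "p x"] orth_projection_idem[OF p] by blast
  ultimately have "inner x (q x) = inner (p x) (q x)" "inner x (p x) = inner (q x) (p x)"
    using symmetric_opD[of p x "q x"] symmetric_opD[of q x "p x"] p q
    by (simp_all add: orth_projection_def)
  then show "inner x (p x) = inner x (q x)" by (simp add: inner_commute)
qed

text \<open>Both families bound the form of \<open>c\<close> by \<open>s\<close> from above on the range at \<open>s\<close> and from below on
  its complement. So each projection at \<open>s\<close> is below the other one at every \<open>t > s\<close>, and right-continuity
  removes the gap. This is the uniqueness half of the spectral theorem.\<close>
lemma (in projection_measure) P_atMost_eq_resolution:
  fixes c :: "'h \<Rightarrow>\<^sub>L 'h"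
  assumes sym: "symmetric_op c" and form: "\<And>\<xi>. inner \<xi> (c \<xi>) = mean \<xi>"
  shows "P {..s} = resolution c s"
proof (rule orth_projection_eqI)
  have comm: "P {..s} (resolution c t v) = resolution c t (P {..s} v)" for s t v
    by (rule resolution_commute[OF sym, symmetric]) (simp add: form_commute[OF sym form])
  have upper: "inner v (c v) \<le> s * (norm v)\<^sup>2" if "P {..s} v = v" for s v
    using mean_upper[OF _ that] by (simp add: form)
  have lower: "s * (norm v)\<^sup>2 \<le> inner v (c v)" if "P {..s} v = 0" for s v
    using mean_lower[of "{s<..}" v s] that by (simp add: form P_greaterThan)
  show "P {..s} v = v \<longleftrightarrow> resolution c s v = v" for v
  proof
    assume v: "P {..s} v = v"
    have "resolution c t v = v" if "s < t" for t
      by (rule projection_order_from_form[OF proj resolution(1)[OF sym] comm upper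
            resolution_lower[OF sym] that v]) simp
    then show "resolution c s v = v"
      unfolding resolution(2)[OF sym] by (rule spectral_subspace_right_continuous)
  next
    assume v: "resolution c s v = v"
    show "P {..s} v = v"
      by (rule P_right_continuous, rule projection_order_from_form[OF resolution(1)[OF sym] proj
            comm[symmetric] resolution_upper[OF sym] lower _ v]) simp_all
  qed
qed (simp_all add: proj resolution(1)[OF sym])

section \<open>Existence of the spectral measure\<close>

text \<open>Apply the hypothesis to \<open>q x\<close>.\<close>
lemma projections_orthogonal:
  fixes p q :: "'a::real_inner \<Rightarrow>\<^sub>L 'a"
  assumes p: "orth_projection p" and q: "orth_projection q"
    and le: "\<And>x. inner x (p x) + inner x (q x) \<le> (norm x)\<^sup>2"
  shows "p (q x) = 0"
proof -
  have "(norm (p (q x)))\<^sup>2 + (norm (q x))\<^sup>2 \<le> (norm (q x))\<^sup>2"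
    using le[of "q x"] orth_projection_form[OF p, of "q x"] orth_projection_form[OF q, of "q x"]
    unfolding orth_projection_idem[OF q] by linarith
  then show ?thesis by simp
qed

lemma scaleC_zero_right: "c *\<^sub>C (0::'h::chilbert_space) = 0"
  using blinfun.zero_right[of "scaleC_op c (id_blinfun :: 'h \<Rightarrow>\<^sub>L 'h)"] by (simp add: scaleC_op.rep_eq)

lemma tendsto_scaleC: "((\<lambda>n. f n) \<longlongrightarrow> l) F \<Longrightarrow> ((\<lambda>n. c *\<^sub>C f n) \<longlongrightarrow> c *\<^sub>C l) F"
  for f :: "_ \<Rightarrow> 'h::chilbert_space"
proof -
  assume "(f \<longlongrightarrow> l) F"
  then have "((\<lambda>n. scaleC_op c id_blinfun (f n)) \<longlongrightarrow> scaleC_op c id_blinfun l) F"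
    by (intro tendsto_intros)
  then show ?thesis by (simp add: scaleC_op.rep_eq)
qed

lemma borel_induct_disjoint [consumes 1, case_names atMost empty compl union]:
  fixes E :: "real set"
  assumes "E \<in> sets borel" "\<And>s. Q {..s}" "Q {}"
    and compl: "\<And>A. A \<in> sets borel \<Longrightarrow> Q A \<Longrightarrow> Q (- A)"
    and union: "\<And>A. disjoint_family A \<Longrightarrow> range A \<subseteq> sets borel \<Longrightarrow> (\<And>i. Q (A i)) \<Longrightarrow> Q (\<Union>i::nat. A i)"
  shows "Q E"
proof -
  have borel: "sets borel = sigma_sets UNIV (range (\<lambda>a::real. {..a}))"
    by (simp add: borel_eq_atMost)
  have "Int_stable (range (\<lambda>a::real. {..a}))"
    by (auto simp: Int_stable_def)
  then show ?thesis
    by (rule sigma_sets_induct_disjoint[where \<Omega> = UNIV])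
      (use assms in \<open>auto simp: borel[symmetric] Compl_eq_Diff_UNIV[symmetric]\<close>)
qed

text \<open>The sets whose scalar measures come from a projection form a Dynkin class. Only disjoint unions
  need an argument: for disjoint sets the two forms add up to at most \<open>(norm \<xi>)\<^sup>2\<close>, so the projections
  are orthogonal and their sum is again a projection. The
  projection is unique because its quadratic form determines a symmetric operator.\<close>
lemma projection_measure_from_scalar_measures:
  fixes \<mu> :: "'h::chilbert_space \<Rightarrow> real measure"
  assumes sets: "\<And>\<xi>. sets (\<mu> \<xi>) = sets borel"
    and total: "\<And>\<xi>. emeasure (\<mu> \<xi>) UNIV = ennreal ((norm \<xi>)\<^sup>2)"
    and half: "\<And>s. \<exists>p. projection_op p \<and> (\<forall>\<xi>. emeasure (\<mu> \<xi>) {..s} = ennreal (inner \<xi> (blinfun_apply p \<xi>)))"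
    and compact: "\<exists>K. \<forall>\<xi>. emeasure (\<mu> \<xi>) {-K..K} = ennreal ((norm \<xi>)\<^sup>2)"
  obtains P where "projection_measure P" "\<And>E. E \<in> sets borel \<Longrightarrow> projection_op (P E)"
    "\<And>E \<xi>. E \<in> sets borel \<Longrightarrow> emeasure (\<mu> \<xi>) E = ennreal (inner \<xi> (P E \<xi>))"
proof -
  define rep :: "real set \<Rightarrow> ('h \<Rightarrow>\<^sub>L 'h) \<Rightarrow> bool"
    where "rep E p \<longleftrightarrow> projection_op p \<and> (\<forall>\<xi>. emeasure (\<mu> \<xi>) E = ennreal (inner \<xi> (p \<xi>)))" for E p
  have space: "space (\<mu> \<xi>) = UNIV" for \<xi> using sets_eq_imp_space_eq[OF sets] by simp
  have proj: "orth_projection p" "p \<in> bounded_ops" if "rep E p" for E p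
    using that by (auto simp: rep_def projection_op_iff)
  have nonneg: "0 \<le> inner \<xi> (p \<xi>)" if "rep E p" for E p \<xi>
    using proj[OF that] by (simp add: orth_projection_form)
  have disj: "p (q x) = 0"
    if p: "rep A p" and q: "rep B q" and "A \<inter> B = {}" "A \<in> sets borel" "B \<in> sets borel" for A B p q x
  proof (rule projections_orthogonal)
    fix \<xi>
    have "ennreal (inner \<xi> (p \<xi>) + inner \<xi> (q \<xi>)) = emeasure (\<mu> \<xi>) A + emeasure (\<mu> \<xi>) B"
      using p q nonneg[OF p] nonneg[OF q] by (simp add: rep_def)
    also have "\<dots> = emeasure (\<mu> \<xi>) (A \<union> B)"
      using that sets by (intro plus_emeasure) auto
    also have "\<dots> \<le> ennreal ((norm \<xi>)\<^sup>2)"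
      unfolding total[symmetric] by (intro emeasure_mono) (auto simp: sets)
    finally show "inner \<xi> (p \<xi>) + inner \<xi> (q \<xi>) \<le> (norm \<xi>)\<^sup>2"
      using ennreal_le_iff by (metis zero_le_power2)
  qed (use proj p q in auto)
  have unique: "p = q" if "rep E p" "rep E q" for E p q
  proof (rule symmetric_op_eqI)
    show "symmetric_op p" "symmetric_op q" using proj that by (auto simp: orth_projection_def)
    show "inner x (p x) = inner x (q x)" for x
      using that nonneg[OF that(1)] nonneg[OF that(2)] by (metis rep_def ennreal_inj)
  qed
  have union_rep: "rep (\<Union>n. A n) q"
    if A: "disjoint_family A" "range A \<subseteq> sets borel" and p: "\<And>n. rep (A n) (p n)"
      and q: "orth_projection q" "\<And>x. (\<lambda>n. p n x) sums q x" for A :: "nat \<Rightarrow> real set" and p q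
  proof -
    have "q (c *\<^sub>C \<xi>) = c *\<^sub>C q \<xi>" for c \<xi>
    proof -
      have "(\<lambda>n. \<Sum>k<n. p k (c *\<^sub>C \<xi>)) = (\<lambda>n. scaleC_op c id_blinfun (\<Sum>k<n. p k \<xi>))"
        unfolding blinfun.sum_right by (simp add: scaleC_op.rep_eq bounded_opsD[OF proj(2)[OF p]])
      then have "(\<lambda>n. \<Sum>k<n. p k (c *\<^sub>C \<xi>)) \<longlonglongrightarrow> c *\<^sub>C q \<xi>"
        using tendsto_scaleC[OF q(2)[unfolded sums_def]] by (simp add: scaleC_op.rep_eq)
      then show ?thesis using q(2)[of "c *\<^sub>C \<xi>"] LIMSEQ_unique unfolding sums_def by blast
    qed
    moreover have "emeasure (\<mu> \<xi>) (\<Union>n. A n) = ennreal (inner \<xi> (q \<xi>))" for \<xi>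
    proof -
      have "emeasure (\<mu> \<xi>) (\<Union>n. A n) = (\<Sum>n. emeasure (\<mu> \<xi>) (A n))"
        using A sets by (intro suminf_emeasure[symmetric]) auto
      also have "\<dots> = (\<Sum>n. ennreal (inner \<xi> (p n \<xi>)))" using p by (simp add: rep_def)
      also have "\<dots> = ennreal (inner \<xi> (q \<xi>))"
        by (intro suminf_ennreal_eq nonneg[OF p] bounded_linear.sums[OF bounded_linear_inner_right q(2)])
      finally show ?thesis .
    qed
    ultimately show "rep (\<Union>n. A n) q"
      using q(1) by (simp add: rep_def projection_op_iff bounded_ops_def)
  qed
  have sumq: "\<exists>q. orth_projection q \<and> (\<forall>x. (\<lambda>n. p n x) sums q x)"
    if A: "disjoint_family A" "range A \<subseteq> sets borel" and p: "\<And>n. rep (A n) (p n)"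
    for A :: "nat \<Rightarrow> real set" and p
  proof -
    have "p m (p n x) = 0" if "m \<noteq> n" for m n x
      using that A by (intro disj[OF p p]) (auto simp: disjoint_family_on_def)
    with proj(1)[OF p] show ?thesis using orthogonal_projections_sum[of p] by metis
  qed
  have compl_rep: "rep (- A) (id_blinfun - p)" if A: "A \<in> sets borel" and p: "rep A p" for A p
    unfolding rep_def projection_op_iff
  proof (intro conjI allI)
    show "id_blinfun - p \<in> bounded_ops" "orth_projection (id_blinfun - p)"
      using proj[OF p] by (auto intro: bounded_ops_closed orth_projection_compl)
    fix \<xi>
    have "emeasure (\<mu> \<xi>) (- A) = ennreal ((norm \<xi>)\<^sup>2) - ennreal (inner \<xi> (p \<xi>))"
      using A p sets emeasure_compl[of A "\<mu> \<xi>"]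
      by (simp add: space total rep_def Compl_eq_Diff_UNIV)
    also have "\<dots> = ennreal (inner \<xi> ((id_blinfun - p) \<xi>))"
      using nonneg[OF p, of \<xi>]
      by (simp add: ennreal_minus blinfun.bilinear_simps inner_simps power2_norm_eq_inner)
    finally show "emeasure (\<mu> \<xi>) (- A) = ennreal (inner \<xi> ((id_blinfun - p) \<xi>))" .
  qed
  have zero: "rep {} 0"
    by (simp add: rep_def projection_op_iff bounded_ops_def orth_projection_def symmetric_op_def
        blinfun.zero_left scaleC_zero_right)
  have ex: "\<exists>p. rep E p" if "E \<in> sets borel" for E
    using that
  proof (induction E rule: borel_induct_disjoint)
    case (atMost s) show ?case using half[of s] by (auto simp: rep_def)
  next
    case empty show ?case using zero by blast
  next
    case (compl A) then show ?case using compl_rep by blast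
  next
    case (union A)
    then obtain p where p: "\<And>n. rep (A n) (p n)" by metis
    obtain q where q: "orth_projection q" "\<And>x. (\<lambda>n. p n x) sums q x"
      using sumq[OF union(1,2) p] by blast
    show ?case using union_rep[OF union(1,2) p q] by blast
  qed
  define P where "P E = (SOME p. rep E p)" for E
  have P: "rep E (P E)" if "E \<in> sets borel" for E
    unfolding P_def using someI_ex[OF ex[OF that]] .
  have P_eq: "P E = p" if "E \<in> sets borel" "rep E p" for E p
    using unique[OF P[OF that(1)] that(2)] .
  have idrep: "rep E id_blinfun" if "\<And>\<xi>. emeasure (\<mu> \<xi>) E = ennreal ((norm \<xi>)\<^sup>2)" for E
    using that by (simp add: rep_def projection_op_iff bounded_ops_closed orth_projection_def
        symmetric_op_def power2_norm_eq_inner)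
  have add: "P (A \<union> B) x = P A x + P B x"
    if A: "A \<in> sets borel" and B: "B \<in> sets borel" and "A \<inter> B = {}" for A B x
  proof -
    have bin: "disjoint_family (binaryset A B)" "range (binaryset A B) \<subseteq> sets borel"
      using that by (auto simp: disjoint_family_on_def binaryset_def)
    have P0: "P {} = 0" using P_eq[OF _ zero] by simp
    have Pbin: "rep (binaryset A B n) (P (binaryset A B n))" for n using bin(2) by (intro P) auto
    obtain q where q: "orth_projection q" "\<And>x. (\<lambda>n. P (binaryset A B n) x) sums q x"
      using sumq[OF bin Pbin] by blast
    have "P (A \<union> B) = q"
      using union_rep[OF bin Pbin q] that by (intro P_eq) (auto simp: UN_binaryset_eq)
    moreover have "(\<lambda>n. P (binaryset A B n) x) sums (P A x + P B x)"
      using binaryset_sums[of "\<lambda>A. P A x" A B] by (simp add: P0 blinfun.zero_left)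
    ultimately show ?thesis using q(2) sums_unique2 by blast
  qed
  show thesis
  proof (rule that)
    show "projection_op (P E)" if "E \<in> sets borel" for E using P[OF that] by (simp add: rep_def)
    show "emeasure (\<mu> \<xi>) E = ennreal (inner \<xi> (P E \<xi>))" if "E \<in> sets borel" for E \<xi>
      using P[OF that] by (simp add: rep_def)
    show "projection_measure P"
    proof
      show "orth_projection (P E)" if "E \<in> sets borel" for E using proj(1)[OF P[OF that]] .
      show "P UNIV = id_blinfun" by (intro P_eq idrep total) simp
      show "\<exists>K. P {-K..K} = id_blinfun" using compact by (auto intro!: P_eq idrep)
      show "P (E \<inter> F) = P E o\<^sub>L P F" if E: "E \<in> sets borel" and F: "F \<in> sets borel" for E F
      proof (rule blinfun_eqI)
        fix x
        let ?I = "E \<inter> F" and ?D = "E - F" and ?G = "F - E"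
        have IDG: "?I \<in> sets borel" "?D \<in> sets borel" "?G \<in> sets borel" using E F by auto
        \<comment> \<open>Split \<open>E\<close> and \<open>F\<close> along their intersection; all mixed products vanish by disjointness.\<close>
        have "P E y = P ?I y + P ?D y" "P F y = P ?I y + P ?G y" for y
          using add[OF IDG(1,2), of y] add[OF IDG(1,3), of y]
          by (simp_all add: Int_Diff_Un Int_Diff_disjoint Int_commute[of E F])
             (metis Int_Diff_Un Int_Diff_disjoint Int_commute)+
        moreover have "P ?I (P ?G x) = 0" "P ?D (P ?I x) = 0" "P ?D (P ?G x) = 0"
          by (rule disj[OF P P]; use IDG in auto)+
        moreover have "P ?I (P ?I x) = P ?I x"
          using orth_projection_idem[OF proj(1)[OF P[OF IDG(1)]]] .
        ultimately show "P ?I x = (P E o\<^sub>L P F) x" by (simp add: blinfun.bilinear_simps)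
      qed
      show "(\<lambda>n. P (A n) \<xi>) sums P (\<Union>n. A n) \<xi>"
        if A: "range A \<subseteq> sets borel" "disjoint_family A" for A :: "nat \<Rightarrow> real set" and \<xi>
      proof -
        have PA: "rep (A n) (P (A n))" for n using A by (intro P) auto
        obtain q where q: "orth_projection q" "\<And>x. (\<lambda>n. P (A n) x) sums q x"
          using sumq[OF A(2,1) PA] by blast
        have "P (\<Union>n. A n) = q" using union_rep[OF A(2,1) PA q] A by (intro P_eq) auto
        then show ?thesis using q(2) by simp
      qed
    qed
  qed
qed

lemma resolution_form_mono:
  assumes c: "symmetric_op c" and "s \<le> t"
  shows "(norm (resolution c s x))\<^sup>2 \<le> (norm (resolution c t x))\<^sup>2"
    and "resolution c s (resolution c t x) = resolution c s x"
proof -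
  let ?p = "resolution c s" and ?q = "resolution c t"
  have p: "orth_projection ?p" and q: "orth_projection ?q" by (rule resolution(1)[OF c])+
  have "inner (?p (?q x) - ?p x) y = 0" for y
    using resolution_mono[OF assms, of y] p q
    by (simp add: orth_projection_def symmetric_op_def inner_diff_left)
  then have "inner (?p (?q x) - ?p x) (?p (?q x) - ?p x) = 0" by blast
  then show eq: "?p (?q x) = ?p x" by simp
  then have "norm (?p x) \<le> norm (?q x)" using orth_projection_norm_le[OF p, of "?q x"] by simp
  then show "(norm (?p x))\<^sup>2 \<le> (norm (?q x))\<^sup>2" by (simp add: power_mono)
qed

text \<open>Along a sequence decreasing to \<open>s\<close> the projections converge strongly, and the limit vector lies
  in every spectral subspace beyond \<open>s\<close>, hence in the one at \<open>s\<close>.\<close>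
lemma resolution_form_right_continuous:
  assumes c: "symmetric_op c"
  shows "continuous (at_right s) (\<lambda>s. (norm (resolution c s x))\<^sup>2)"
proof (subst continuous_at_right_real_increasing, rule resolution_form_mono(1)[OF c], assumption,
    intro allI impI)
  fix \<epsilon> :: real assume "0 < \<epsilon>"
  define t where "t n = s + inverse (real (Suc n))" for n
  have t: "s < t n" "t (Suc n) \<le> t n" for n by (auto simp: t_def field_simps)
  have t_less: "\<exists>n. \<forall>m\<ge>n. t m \<le> u" if "s < u" for u
  proof -
    obtain n where "inverse (real (Suc n)) < u - s" using reals_Archimedean[of "u - s"] \<open>s < u\<close> by (auto simp del: of_nat_Suc)
    moreover have "inverse (real (Suc m)) \<le> inverse (real (Suc n))" if "m \<ge> n" for m
      using that by (intro le_imp_inverse_le) auto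
    ultimately have "t m \<le> u" if "m \<ge> n" for m
      using that unfolding t_def by (metis add.commute diff_ge_0_iff_ge dual_order.trans le_diff_eq less_imp_le)
    then show ?thesis by blast
  qed
  let ?S = "\<lambda>n. id_blinfun - resolution c (t n)"
  have "orth_projection (?S n)" for n by (intro orth_projection_compl resolution(1)[OF c])
  moreover have "?S (Suc n) (?S n y) = ?S n y" for n y
    by (simp add: blinfun.bilinear_simps resolution_form_mono(2)[OF c t(2)])
  ultimately obtain p where p: "\<And>x. (\<lambda>n. ?S n x) \<longlonglongrightarrow> p x"
    using increasing_projections_converge[of ?S] by metis
  define y where "y = x - p x"
  have y: "(\<lambda>n. resolution c (t n) x) \<longlonglongrightarrow> y"
    using tendsto_diff[OF tendsto_const[of x] p[of x]] by (simp add: y_def blinfun.bilinear_simps)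
  have "resolution c u y = y" if "s < u" for u
  proof (rule LIMSEQ_unique[OF _ y])
    obtain n where n: "\<forall>m\<ge>n. t m \<le> u" using t_less[OF \<open>s < u\<close>] by blast
    have "(\<lambda>m. resolution c u (resolution c (t m) x)) \<longlonglongrightarrow> resolution c u y" by (intro tendsto_intros y)
    then show "(\<lambda>m. resolution c (t m) x) \<longlonglongrightarrow> resolution c u y"
      by (rule Lim_transform_eventually)
        (use n in \<open>auto simp: eventually_sequentially resolution_mono[OF c] intro!: exI[of _ n]\<close>)
  qed
  then have "resolution c s y = y"
    unfolding resolution(2)[OF c] by (rule spectral_subspace_right_continuous)
  moreover have "resolution c s y = resolution c s x"
  proof (rule LIMSEQ_unique)
    show "(\<lambda>m. resolution c s (resolution c (t m) x)) \<longlonglongrightarrow> resolution c s y" by (intro tendsto_intros y)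
    show "(\<lambda>m. resolution c s (resolution c (t m) x)) \<longlonglongrightarrow> resolution c s x"
      using resolution_form_mono(2)[OF c less_imp_le[OF t(1)]] by simp
  qed
  ultimately have "(\<lambda>n. (norm (resolution c (t n) x))\<^sup>2) \<longlonglongrightarrow> (norm (resolution c s x))\<^sup>2"
    using tendsto_power[OF tendsto_norm[OF y]] by simp
  from LIMSEQ_D[OF this \<open>0 < \<epsilon>\<close>] obtain n
    where "(norm (resolution c (t n) x))\<^sup>2 - (norm (resolution c s x))\<^sup>2 < \<epsilon>" by (auto simp: abs_less_iff)
  then show "\<exists>\<delta>>0. (norm (resolution c (s + \<delta>) x))\<^sup>2 - (norm (resolution c s x))\<^sup>2 < \<epsilon>"
    by (intro exI[of _ "inverse (real (Suc n))"]) (simp add: t_def)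
qed

lemma projection_op_resolution:
  fixes c :: "'h::chilbert_space \<Rightarrow>\<^sub>L 'h"
  assumes "c \<in> bounded_ops" "symmetric_op c"
  shows "projection_op (resolution c s)"
proof -
  have "resolution c s (z *\<^sub>C v) = z *\<^sub>C resolution c s v" for z v
    using resolution_commute[OF assms(2), of "scaleC_op z id_blinfun" s v] bounded_opsD[OF assms(1)]
    by (simp add: scaleC_op.rep_eq)
  then show ?thesis
    using resolution(1)[OF assms(2)] by (simp add: projection_op_iff bounded_ops_def)
qed

text \<open>The spectral theorem for bounded self-adjoint operators. The scalar measure of \<open>\<xi>\<close> is the
  Stieltjes measure of \<open>s \<mapsto> (norm (E s \<xi>))\<^sup>2\<close>, where \<open>E s\<close> projects onto the spectral subspace.\<close>
theorem spectral_measure_exists: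
  fixes c :: "'h::chilbert_space \<Rightarrow>\<^sub>L 'h"
  assumes c: "c \<in> bounded_ops" and sym: "symmetric_op c"
  shows "\<exists>P. is_spectral_measure c P"
proof -
  define F where "F \<xi> s = (norm (resolution c s \<xi>))\<^sup>2" for \<xi> s
  define \<mu> where "\<mu> \<xi> = interval_measure (F \<xi>)" for \<xi>
  have mono: "F \<xi> s \<le> F \<xi> t" if "s \<le> t" for \<xi> s t
    unfolding F_def by (rule resolution_form_mono(1)[OF sym that])
  have cont: "continuous (at_right s) (F \<xi>)" for \<xi> s
    unfolding F_def by (rule resolution_form_right_continuous[OF sym])
  have bot: "F \<xi> s = 0" if "s < - norm c" for \<xi> s
  proof -
    have "resolution c s (resolution c s \<xi>) = resolution c s \<xi>"
      by (rule orth_projection_idem[OF resolution(1)[OF sym]])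
    then show ?thesis by (simp add: F_def resolution(2)[OF sym] spectral_subspace_trivial[OF that])
  qed
  have top: "F \<xi> s = (norm \<xi>)\<^sup>2" if "norm c \<le> s" for \<xi> s
  proof -
    have "resolution c s \<xi> = \<xi>" by (simp add: resolution(2)[OF sym] spectral_subspace_UNIV[OF that])
    then show ?thesis by (simp add: F_def)
  qed
  have lim_bot: "(F \<xi> \<longlongrightarrow> 0) at_bot" for \<xi>
    by (rule tendsto_eventually)
      (auto simp: eventually_at_bot_dense bot intro!: exI[of _ "- norm c"])
  have lim_top: "(F \<xi> \<longlongrightarrow> (norm \<xi>)\<^sup>2) at_top" for \<xi>
    by (rule tendsto_eventually)
      (auto simp: eventually_at_top_linorder top intro!: exI[of _ "norm c"])
  have total: "emeasure (\<mu> \<xi>) UNIV = ennreal ((norm \<xi>)\<^sup>2)" for \<xi>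
    unfolding \<mu>_def by (rule interval_measure_UNIV[OF mono cont lim_bot lim_top]) simp_all
  have half: "emeasure (\<mu> \<xi>) {..s} = ennreal (F \<xi> s)" for \<xi> s
    unfolding \<mu>_def by (rule emeasure_interval_measure_Iic[OF mono cont lim_bot]) simp_all
  have form: "F \<xi> s = inner \<xi> (resolution c s \<xi>)" for \<xi> s
    by (simp add: F_def orth_projection_form[OF resolution(1)[OF sym]])
  have compact: "emeasure (\<mu> \<xi>) {-(norm c + 1)..norm c + 1} = ennreal ((norm \<xi>)\<^sup>2)" for \<xi>
  proof (rule antisym)
    show "emeasure (\<mu> \<xi>) {-(norm c + 1)..norm c + 1} \<le> ennreal ((norm \<xi>)\<^sup>2)"
      unfolding total[symmetric] by (rule emeasure_mono) (auto simp: \<mu>_def)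
    have "emeasure (\<mu> \<xi>) {-(norm c + 1)<..norm c} = ennreal ((norm \<xi>)\<^sup>2)"
      unfolding \<mu>_def using norm_ge_zero[of c]
      by (subst emeasure_interval_measure_Ioc[OF _ mono cont]) (simp_all add: bot top del: norm_ge_zero)
    then show "ennreal ((norm \<xi>)\<^sup>2) \<le> emeasure (\<mu> \<xi>) {-(norm c + 1)..norm c + 1}"
      by (metis (no_types, lifting) emeasure_mono \<mu>_def sets_interval_measure atLeastAtMost_borel
          greaterThanAtMost_subseteq_atLeastAtMost_iff add_increasing2 order_refl zero_le_one)
  qed
  obtain P where P: "projection_measure P" and projP: "\<And>E. E \<in> sets borel \<Longrightarrow> projection_op (P E)"
    and meas: "\<And>E \<xi>. E \<in> sets borel \<Longrightarrow> emeasure (\<mu> \<xi>) E = ennreal (inner \<xi> (P E \<xi>))"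
  proof (rule projection_measure_from_scalar_measures[of \<mu>])
    show "\<exists>p. projection_op p \<and> (\<forall>\<xi>. emeasure (\<mu> \<xi>) {..s} = ennreal (inner \<xi> (blinfun_apply p \<xi>)))" for s
      by (intro exI[of _ "resolution c s"]) (simp add: half form projection_op_resolution[OF c sym])
    show "\<exists>K. \<forall>\<xi>. emeasure (\<mu> \<xi>) {-K..K} = ennreal ((norm \<xi>)\<^sup>2)" using compact by blast
  qed (auto simp: \<mu>_def total[unfolded \<mu>_def])
  interpret projection_measure P by fact
  have PR: "P {..s} = resolution c s" for s
  proof (rule symmetric_op_eqI)
    show "symmetric_op (P {..s})" "symmetric_op (resolution c s)"
      using projection_measure.proj[OF P, of "{..s}"] resolution(1)[OF sym] by (auto simp: orth_projection_def)
    fix x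
    have "ennreal (inner x (P {..s} x)) = ennreal (inner x (resolution c s x))"
      using meas[of "{..s}" x] half[of x s] by (simp add: form)
    moreover have "0 \<le> inner x (P {..s} x)" "0 \<le> inner x (resolution c s x)"
      using orth_projection_form[OF projection_measure.proj[OF P, of "{..s}"]]
        orth_projection_form[OF resolution(1)[OF sym]] by simp_all
    ultimately show "inner x (P {..s} x) = inner x (resolution c s x)" by simp
  qed
  have "inner \<xi> (c \<xi>) = mean \<xi>" for \<xi>
    by (rule mean_eq_form[OF _ sym])
      (auto simp: PR resolution_upper[OF sym] resolution_lower[OF sym] resolution_commute[OF sym])
  then have "cinner \<xi> (c \<xi>) = complex_of_real (\<integral>t. t \<partial>vector_measure P \<xi>)" for \<xi>
    by (simp add: cinner_symmetric[OF c sym] mean_def)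
  then have "is_spectral_measure c P"
    unfolding is_spectral_measure_def using projP P_UNIV P_Int P_sums P_compact
    by (intro conjI ballI allI impI) auto
  then show ?thesis by blast
qed

lemma spectral_measure_projection_measure:
  assumes "is_spectral_measure c P"
  shows "projection_measure P"
  using assms unfolding is_spectral_measure_def
  by unfold_locales (auto simp: projection_op_iff)

section \<open>Spectral projections lie in the von Neumann algebra\<close>

lemma commutantD:
  assumes "x \<in> commutant N" "z \<in> N"
  shows "blinfun_apply z (blinfun_apply x v) = x (z v)"
proof -
  have "z o\<^sub>L x = x o\<^sub>L z" using assms by (simp add: commutant_def)
  from arg_cong[OF this, of "\<lambda>T. blinfun_apply T v"] show ?thesis by simp
qed

lemma commutantI:
  "x \<in> bounded_ops \<Longrightarrow> (\<And>z v. z \<in> N \<Longrightarrow> blinfun_apply z (blinfun_apply x v) = x (z v)) \<Longrightarrow> x \<in> commutant N"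
  unfolding commutant_def by (auto intro: blinfun_eqI)

lemma commutant_bounded: "x \<in> commutant N \<Longrightarrow> x \<in> bounded_ops"
  by (simp add: commutant_def)

lemma commutant_closed:
  assumes "x \<in> commutant N" "y \<in> commutant N"
  shows "x + y \<in> commutant N" "x - y \<in> commutant N" "x o\<^sub>L y \<in> commutant N"
proof -
  have bounded: "x \<in> bounded_ops" "y \<in> bounded_ops" using assms by (simp_all add: commutant_bounded)
  have comm: "blinfun_apply z (x v) = x (z v)" "blinfun_apply z (y v) = y (z v)" if "z \<in> N" for z v
    using commutantD[OF assms(1) that] commutantD[OF assms(2) that] by simp_all
  show "x + y \<in> commutant N"
    by (rule commutantI) (simp_all only: bounded_ops_closed bounded comm blinfun.add_left blinfun.add_right)
  show "x - y \<in> commutant N"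
    by (rule commutantI) (simp_all only: bounded_ops_closed bounded comm blinfun.diff_left blinfun.diff_right)
  show "x o\<^sub>L y \<in> commutant N"
    by (rule commutantI) (simp_all only: bounded_ops_closed bounded comm blinfun_apply_blinfun_compose)
qed

lemma id_in_commutant: "id_blinfun \<in> commutant N"
  by (rule commutantI) (simp_all add: bounded_ops_closed)

lemma von_neumann_closed:
  assumes M: "von_neumann_algebra M"
  shows "x \<in> M \<Longrightarrow> y \<in> M \<Longrightarrow> x + y \<in> M" "x \<in> M \<Longrightarrow> y \<in> M \<Longrightarrow> x - y \<in> M"
    "x \<in> M \<Longrightarrow> y \<in> M \<Longrightarrow> x o\<^sub>L y \<in> M" "id_blinfun \<in> M"
proof -
  have eq: "commutant (commutant M) = M" using M by (simp add: von_neumann_algebra_def)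
  show "x \<in> M \<Longrightarrow> y \<in> M \<Longrightarrow> x + y \<in> M" "x \<in> M \<Longrightarrow> y \<in> M \<Longrightarrow> x - y \<in> M"
    "x \<in> M \<Longrightarrow> y \<in> M \<Longrightarrow> x o\<^sub>L y \<in> M"
    using commutant_closed[of x "commutant M" y] unfolding eq by blast+
  show "id_blinfun \<in> M" using id_in_commutant[of "commutant M"] unfolding eq .
qed

text \<open>For half-lines this is the invariance of the spectral subspaces; the sets with this property
  form a Dynkin class.\<close>
lemma (in projection_measure) P_commute:
  fixes c y :: "'h \<Rightarrow>\<^sub>L 'h"
  assumes sym: "symmetric_op c" and form: "\<And>\<xi>. inner \<xi> (c \<xi>) = mean \<xi>"
    and comm: "\<And>u. c (y u) = y (c u)" and E: "E \<in> sets borel"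
  shows "P E (y v) = y (P E v)"
  using E
proof (induction E arbitrary: v rule: borel_induct_disjoint)
  case (atMost s)
  show ?case by (simp add: P_atMost_eq_resolution[OF sym form] resolution_commute[OF sym comm])
next
  case empty show ?case by (simp add: P_empty blinfun.bilinear_simps)
next
  case (compl A) then show ?case by (simp add: P_Compl blinfun.bilinear_simps)
next
  case (union A)
  have "(\<lambda>n. y (P (A n) v)) sums y (P (\<Union>n. A n) v)"
    by (rule bounded_linear.sums[OF blinfun.bounded_linear_right P_sums[OF union(2,1)]])
  then show ?case using P_sums[OF union(2,1), of "y v"] sums_unique2 by (simp add: union(3)) blast
qed

text \<open>The real form of the defining property of a spectral measure of \<open>c\<close>.\<close>
locale spectral_measure = projection_measure P for P :: "real set \<Rightarrow> ('h::chilbert_space \<Rightarrow>\<^sub>L 'h)" +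
  fixes c :: "'h \<Rightarrow>\<^sub>L 'h"
  assumes sym: "symmetric_op c" and form: "\<And>\<xi>. inner \<xi> (c \<xi>) = mean \<xi>"
    and P_bounded: "\<And>E. E \<in> sets borel \<Longrightarrow> P E \<in> bounded_ops"

text \<open>An operator in the commutant of \<open>M\<close> commutes with \<open>c\<close>, hence with \<open>P E\<close>; so \<open>P E\<close> lies in the
  double commutant.\<close>
lemma (in spectral_measure) P_in_von_neumann:
  assumes "von_neumann_algebra M" "c \<in> M" "E \<in> sets borel"
  shows "P E \<in> M"
proof -
  have "y o\<^sub>L P E = P E o\<^sub>L y" if "y \<in> commutant M" for y
  proof (rule blinfun_eqI)
    fix v
    have "c (y u) = y (c u)" for u by (rule commutantD[OF that assms(2)])
    from P_commute[OF sym form this assms(3)]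
    show "(y o\<^sub>L P E) v = (P E o\<^sub>L y) v" by simp
  qed
  then have "P E \<in> commutant (commutant M)"
    using P_bounded[OF assms(3)] unfolding commutant_def[of "commutant M"] by simp
  then show ?thesis using assms(1) by (simp add: von_neumann_algebra_def)
qed

lemma spectral_projection_spectral_measure:
  fixes c :: "'h::chilbert_space \<Rightarrow>\<^sub>L 'h"
  assumes c: "c \<in> bounded_ops" and sym: "symmetric_op c"
  shows "spectral_measure (spectral_projection c) c"
proof -
  have S: "is_spectral_measure c (spectral_projection c)"
    unfolding spectral_projection_def by (rule someI_ex[OF spectral_measure_exists[OF assms]])
  interpret projection_measure "spectral_projection c"
    by (rule spectral_measure_projection_measure[OF S])
  show ?thesis
  proof
    show "inner \<xi> (c \<xi>) = mean \<xi>" for \<xi>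
    proof -
      have "cinner \<xi> (c \<xi>) = complex_of_real (mean \<xi>)"
        using S by (simp add: is_spectral_measure_def mean_def)
      then show ?thesis by (simp flip: Re_cinner)
    qed
    show "spectral_projection c E \<in> bounded_ops" if "E \<in> sets borel" for E
      using S that by (simp add: is_spectral_measure_def projection_op_def)
  qed fact
qed

section \<open>Comparing traces of projections\<close>

text \<open>Rotating the second argument by a phase makes the complex inner product real.\<close>
lemma cmod_cinner_le: "cmod (cinner x y) \<le> norm x * norm y" for x y :: "'h::chilbert_space"
proof (cases "cinner x y = 0")
  case False
  define w where "w = cinner x y"
  define z where "z = cnj w / complex_of_real (cmod w)"
  have w: "w \<noteq> 0" using False by (simp add: w_def)
  have "z * w = (complex_of_real (cmod w))\<^sup>2 / complex_of_real (cmod w)"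
    by (simp add: z_def mult.commute flip: complex_norm_square)
  also have "\<dots> = complex_of_real (cmod w)" using w by (simp add: power2_eq_square)
  finally have "cmod w = inner x (z *\<^sub>C y)"
    by (simp add: w_def cinner_scaleC_right flip: Re_cinner)
  also have "\<dots> \<le> norm x * norm (z *\<^sub>C y)" by (rule norm_cauchy_schwarz)
  also have "norm (z *\<^sub>C y) = norm y" using w by (simp add: norm_scaleC z_def norm_divide)
  finally show ?thesis by (simp add: w_def)
qed simp

text \<open>Dominated convergence for the series that defines the functional.\<close>
lemma normal_functional_tendsto_0:
  fixes x :: "nat \<Rightarrow> 'h::chilbert_space \<Rightarrow>\<^sub>L 'h"
  assumes "normal_functional M \<phi>" and M: "\<And>n. x n \<in> M"
    and bound: "\<And>n v. norm (x n v) \<le> norm v" and lim: "\<And>v. (\<lambda>n. x n v) \<longlonglongrightarrow> 0"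
  shows "(\<lambda>n. \<phi> (x n)) \<longlonglongrightarrow> 0"
proof -
  obtain \<xi> \<eta> :: "nat \<Rightarrow> 'h" where sq: "summable (\<lambda>k. (norm (\<xi> k))\<^sup>2)" "summable (\<lambda>k. (norm (\<eta> k))\<^sup>2)"
    and \<phi>: "\<And>y. y \<in> M \<Longrightarrow> (\<lambda>k. cinner (\<xi> k) (y (\<eta> k))) sums \<phi> y"
    using assms(1) unfolding normal_functional_def by blast
  define a where "a k n = cinner (\<xi> k) (x n (\<eta> k))" for k n
  have "cmod (a k n) \<le> norm (\<xi> k) * norm (x n (\<eta> k))" for k n
    unfolding a_def by (rule cmod_cinner_le)
  note le = this
  have "(\<lambda>n. a k n) \<longlonglongrightarrow> 0" for k
  proof (rule Lim_null_comparison)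
    show "\<forall>\<^sub>F n in sequentially. norm (a k n) \<le> norm (\<xi> k) * norm (x n (\<eta> k))" using le by simp
    have "(\<lambda>n. norm (\<xi> k) * norm (x n (\<eta> k))) \<longlonglongrightarrow> norm (\<xi> k) * norm (0::'h)"
      by (intro tendsto_intros lim)
    then show "(\<lambda>n. norm (\<xi> k) * norm (x n (\<eta> k))) \<longlonglongrightarrow> 0" by simp
  qed
  moreover have "cmod (a k n) \<le> (norm (\<xi> k))\<^sup>2 + (norm (\<eta> k))\<^sup>2" for k n
  proof -
    have "cmod (a k n) \<le> norm (\<xi> k) * norm (\<eta> k)"
      by (rule order_trans[OF le mult_left_mono[OF bound]]) simp
    also have "\<dots> \<le> (norm (\<xi> k))\<^sup>2 + (norm (\<eta> k))\<^sup>2"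
      using sum_squares_bound[of "norm (\<xi> k)" "norm (\<eta> k)"] mult_nonneg_nonneg[OF norm_ge_zero[of "\<xi> k"] norm_ge_zero[of "\<eta> k"]]
      by linarith
    finally show ?thesis .
  qed
  then have "\<forall>\<^sub>F (k, n) in sequentially \<times>\<^sub>F sequentially. norm (a k n) \<le> (norm (\<xi> k))\<^sup>2 + (norm (\<eta> k))\<^sup>2"
    by (intro always_eventually) auto
  ultimately have "(\<lambda>n. suminf (\<lambda>k. a k n)) \<longlonglongrightarrow> suminf (\<lambda>k. 0)"
    using tannerys_theorem[of a "\<lambda>k. 0" sequentially, OF _ _ summable_add[OF sq]] by simp
  moreover have "suminf (\<lambda>k. a k n) = \<phi> (x n)" for n
    using sums_unique[OF \<phi>[OF M[of n]]] by (simp add: a_def)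
  ultimately show ?thesis by simp
qed

text \<open>Powers of an element \<open>T\<close> of the corner cut out by \<open>p\<close>, whose unit, and so the zeroth power, is
  \<open>p\<close>.\<close>
fun corner_power :: "('a::real_normed_vector \<Rightarrow>\<^sub>L 'a) \<Rightarrow> ('a \<Rightarrow>\<^sub>L 'a) \<Rightarrow> nat \<Rightarrow> ('a \<Rightarrow>\<^sub>L 'a)" where
  "corner_power p T 0 = p"
| "corner_power p T (Suc n) = corner_power p T n o\<^sub>L T"

lemma corner_power_in: 
  assumes "von_neumann_algebra M" "p \<in> M" "T \<in> M"
  shows "corner_power p T n \<in> M"
  by (induction n) (simp_all add: assms von_neumann_closed(3)[OF assms(1)])

locale corner =
  fixes p T :: "'a::{real_inner, banach} \<Rightarrow>\<^sub>L 'a"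
  assumes p: "orth_projection p" and symT: "symmetric_op T"
    and pT: "p o\<^sub>L T = T" and Tp: "T o\<^sub>L p = T"
begin

abbreviation "X \<equiv> corner_power p T"

lemma X_p: "X n o\<^sub>L p = X n"
proof (cases n)
  case 0 then show ?thesis using p by (auto intro!: blinfun_eqI simp: orth_projection_idem)
qed (simp add: blinfun_compose_simps(7) Tp)

lemma X_add: "X (m + n) = X m o\<^sub>L X n"
  by (induction n) (simp_all add: X_p blinfun_compose_simps(7))

lemma X_T: "T (X n v) = X (Suc n) v" "X n (T v) = X (Suc n) v"
  using arg_cong[OF X_add[of 1 n], of "\<lambda>S. blinfun_apply S v"] by (simp_all add: pT)

lemma X_symmetric: "symmetric_op (X n)"
proof (induction n)
  case 0 then show ?case using p by (simp add: orth_projection_def)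
next
  case (Suc n)
  have "inner (X n (T u)) v = inner u (X n (T v))" for u v
  proof -
    have "inner (X n (T u)) v = inner u (T (X n v))"
      by (rule trans[OF symmetric_opD[OF Suc] symmetric_opD[OF symT]])
    then show ?thesis by (simp only: X_T)
  qed
  then show ?case by (simp add: symmetric_op_def)
qed

lemma X_norm_le:
  assumes "\<And>v. norm (T v) \<le> norm v"
  shows "norm (X n v) \<le> norm v"
proof (induction n arbitrary: v)
  case 0 then show ?case using orth_projection_norm_le[OF p] by simp
next
  case (Suc n) show ?case using Suc[of "T v"] assms[of v] by simp
qed

end

text \<open>The hypotheses say \<open>T\<^sup>2 \<le> T \<le> 1\<close>, so \<open>inner v (T\<^sup>n v)\<close> decreases to a limit. As
  \<open>inner (T\<^sup>m v) (T\<^sup>n v)\<close> depends only on \<open>m + n\<close>, the vectors \<open>T\<^sup>n v\<close> form a Cauchy sequence, and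
  its limit is fixed by \<open>T\<close>.\<close>
lemma (in corner) X_tendsto_0:
  assumes T: "\<And>v. (norm (T v))\<^sup>2 \<le> inner v (T v)" "\<And>v. inner v (T v) \<le> (norm v)\<^sup>2"
    and no_fixed: "\<And>v. T v = v \<Longrightarrow> v = 0"
  shows "(\<lambda>n. X n v) \<longlonglongrightarrow> 0"
proof -
  define b where "b n = inner v (X n v)" for n
  have X_inner: "inner (X m v) (X n v) = b (m + n)" for m n
    using symmetric_opD[OF X_symmetric, of m v "X n v"] by (simp add: b_def X_add)
  have even: "b (n + n) = (norm (X n v))\<^sup>2" for n
    by (simp add: power2_norm_eq_inner X_inner)
  have odd: "b (Suc (n + n)) = inner (X n v) (T (X n v))" for n
    using X_inner[of n "Suc n"] by (simp only: X_T(1) add_Suc_right)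
  have next_even: "b (Suc (Suc (n + n))) = (norm (T (X n v)))\<^sup>2" for n
    using even[of "Suc n"] by (simp only: X_T(1) add_Suc_right add_Suc)
  have step: "b (Suc n) \<le> b n" for n
  proof (cases "even n")
    case True
    then obtain k where "n = k + k" by (metis dvd_def mult_2)
    then show ?thesis using T(2)[of "X k v"] by (simp add: even odd)
  next
    case False
    then obtain k where "n = Suc (k + k)" by (metis oddE Suc_eq_plus1 mult_2)
    then show ?thesis using T(1)[of "X k v"] by (simp add: odd next_even)
  qed
  have "0 \<le> b n" for n
  proof (cases "even n")
    case True
    then obtain k where "n = k + k" by (metis dvd_def mult_2)
    then show ?thesis by (simp add: even)
  next
    case False
    then obtain k where "n = Suc (k + k)" by (metis oddE Suc_eq_plus1 mult_2)
    then show ?thesis using order_trans[OF zero_le_power2 T(1)[of "X k v"]] by (simp add: odd)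
  qed
  then have "convergent b"
    using decseq_convergent[of b 0] decseq_SucI[of b, OF step] by (metis convergentI)
  then have cau: "Cauchy b" by (simp add: Cauchy_convergent_iff)
  have "Cauchy (\<lambda>n. X n v)"
  proof (rule CauchyI)
    fix e :: real assume "0 < e"
    then obtain N where N: "\<And>m n. m \<ge> N \<Longrightarrow> n \<ge> N \<Longrightarrow> norm (b m - b n) < e\<^sup>2 / 2"
      using CauchyD[OF cau, of "e\<^sup>2 / 2"] by auto
    show "\<exists>N. \<forall>m\<ge>N. \<forall>n\<ge>N. norm (X m v - X n v) < e"
    proof (intro exI[of _ N] allI impI)
      fix m n assume "N \<le> m" "N \<le> n"
      have "(norm (X m v - X n v))\<^sup>2 = (b (m + m) - b (m + n)) + (b (n + n) - b (m + n))"
        by (simp add: power2_norm_eq_inner inner_simps X_inner add.commute)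
      also have "\<dots> < e\<^sup>2 / 2 + e\<^sup>2 / 2"
        using N[of "m + m" "m + n"] N[of "n + n" "m + n"] \<open>N \<le> m\<close> \<open>N \<le> n\<close>
        by (intro add_strict_mono) (simp_all only: real_norm_def abs_less_iff trans_le_add1)
      finally show "norm (X m v - X n v) < e"
        using \<open>0 < e\<close> by (simp add: power2_less_imp_less)
    qed
  qed
  then obtain l where l: "(\<lambda>n. X n v) \<longlonglongrightarrow> l" by (auto simp: Cauchy_convergent_iff convergent_def)
  have "(\<lambda>n. T (X n v)) \<longlonglongrightarrow> T l" by (intro tendsto_intros l)
  then have "(\<lambda>n. X (Suc n) v) \<longlonglongrightarrow> T l" by (simp only: X_T(1))
  then have "T l = l" using LIMSEQ_Suc[OF l] by (rule LIMSEQ_unique)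
  then have "l = 0" by (rule no_fixed)
  with l show ?thesis by (simp only:)
qed

lemma tracial_stateD:
  assumes "faithful_normal_tracial_state M \<tau>"
  shows "x \<in> M \<Longrightarrow> y \<in> M \<Longrightarrow> \<tau> (x + y) = \<tau> x + \<tau> y"
    and "x \<in> M \<Longrightarrow> y \<in> M \<Longrightarrow> \<tau> (x o\<^sub>L y) = \<tau> (y o\<^sub>L x)"
    and "x \<in> M \<Longrightarrow> positive_op x \<Longrightarrow> 0 \<le> Re (\<tau> x)"
    and "\<tau> id_blinfun = 1"
    and "normal_functional M \<tau>"
proof -
  have "\<forall>x\<in>M. \<forall>y\<in>M. \<tau> (x + y) = \<tau> x + \<tau> y" "\<forall>x\<in>M. \<forall>y\<in>M. \<tau> (x o\<^sub>L y) = \<tau> (y o\<^sub>L x)"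
    "\<forall>x\<in>M. positive_op x \<longrightarrow> \<tau> x \<in> \<real>\<^sub>\<ge>\<^sub>0"
    using assms unfolding faithful_normal_tracial_state_def by - (elim conjE, assumption)+
  then show "x \<in> M \<Longrightarrow> y \<in> M \<Longrightarrow> \<tau> (x + y) = \<tau> x + \<tau> y"
    "x \<in> M \<Longrightarrow> y \<in> M \<Longrightarrow> \<tau> (x o\<^sub>L y) = \<tau> (y o\<^sub>L x)"
    "x \<in> M \<Longrightarrow> positive_op x \<Longrightarrow> 0 \<le> Re (\<tau> x)"
    by (auto simp: complex_nonneg_Reals_iff)
  show "\<tau> id_blinfun = 1" "normal_functional M \<tau>"
    using assms unfolding faithful_normal_tracial_state_def by - (elim conjE, assumption)+
qed

text \<open>With \<open>T = p (1 - r) p\<close> and \<open>S = r (1 - p) r\<close> one has \<open>T p r = p r S\<close>, hence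
  \<open>T\<^sup>n p r = p r S\<^sup>n\<close>. By the trace property, replacing \<open>n\<close> by \<open>n + 1\<close> then lowers \<open>\<tau> (T\<^sup>n)\<close> and
  \<open>\<tau> (S\<^sup>n)\<close> by the same amount \<open>\<tau> (S\<^sup>n r p r)\<close>, so that their difference stays equal to
  \<open>\<tau> p - \<tau> r\<close>. Now \<open>T\<^sup>n\<close> tends to \<open>0\<close>, while \<open>S\<^sup>n\<close> is positive for even \<open>n\<close>.\<close>
lemma trace_projection_le:
  fixes M :: "('h::chilbert_space \<Rightarrow>\<^sub>L 'h) set"
  assumes M: "von_neumann_algebra M" and \<tau>: "faithful_normal_tracial_state M \<tau>"
    and pM: "p \<in> M" and rM: "r \<in> M" and p: "orth_projection p" and r: "orth_projection r"
    and disj: "\<And>v. p v = v \<Longrightarrow> r v = 0 \<Longrightarrow> v = 0"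
  shows "Re (\<tau> p) \<le> Re (\<tau> r)"
proof -
  note add = tracial_stateD(1)[OF \<tau>] and trace = tracial_stateD(2)[OF \<tau>]
  note closed = von_neumann_closed[OF M]
  have diff: "\<tau> (x - y) = \<tau> x - \<tau> y" if "x \<in> M" "y \<in> M" for x y
    using add[of "x - y" y] that closed(2) by simp
  have pp: "p o\<^sub>L p = p" and rr: "r o\<^sub>L r = r"
    using p r by (auto intro!: blinfun_eqI simp: orth_projection_idem)
  define T where "T = p - (p o\<^sub>L r o\<^sub>L p)"
  define S where "S = r - (r o\<^sub>L p o\<^sub>L r)"
  have T_app: "T v = p (p v - r (p v))" for v
    by (simp add: T_def blinfun.bilinear_simps orth_projection_idem[OF p])
  have TM: "T \<in> M" and SM: "S \<in> M" unfolding T_def S_def using pM rM closed by auto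
  have symp: "symmetric_op p" "symmetric_op r" using p r by (auto simp: orth_projection_def)
  interpret x: corner p T
  proof
    show "symmetric_op T" "p o\<^sub>L T = T" "T o\<^sub>L p = T"
      using symp by (auto intro!: blinfun_eqI simp: T_def symmetric_op_def blinfun.bilinear_simps inner_simps orth_projection_idem[OF p])
  qed (rule p)
  interpret y: corner r S
  proof
    show "symmetric_op S" "r o\<^sub>L S = S" "S o\<^sub>L r = S"
      using symp by (auto intro!: blinfun_eqI simp: S_def symmetric_op_def blinfun.bilinear_simps inner_simps orth_projection_idem[OF r])
  qed (rule r)
  have xM: "x.X n \<in> M" and yM: "y.X n \<in> M" for n
    using corner_power_in[OF M pM TM] corner_power_in[OF M rM SM] by auto
  have form_T: "inner v (T v) = (norm (p v - r (p v)))\<^sup>2" for v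
  proof -
    have "inner v (T v) = inner (p v) (p v - r (p v))"
      using symp(1) by (simp add: T_app symmetric_op_def)
    also have "\<dots> = (norm (p v - r (p v)))\<^sup>2"
      using orth_projection_inner(1)[OF r, of "p v" "p v"]
      by (simp add: power2_norm_eq_inner inner_simps inner_commute)
    finally show ?thesis .
  qed
  have T1: "(norm (T v))\<^sup>2 \<le> inner v (T v)" for v
    unfolding form_T unfolding T_app by (intro power_mono orth_projection_norm_le[OF p]) simp
  have rle: "norm (p v - r (p v)) \<le> norm (p v)" for v
    using orth_projection_norm_le[OF orth_projection_compl[OF r], of "p v"] by (simp add: blinfun.bilinear_simps)
  have T2: "inner v (T v) \<le> (norm v)\<^sup>2" for v
    using order_trans[OF rle orth_projection_norm_le[OF p]] by (simp add: form_T power_mono)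
  have T3: "norm (T v) \<le> norm v" for v
    using order_trans[OF T1 T2] power2_le_imp_le norm_ge_zero by blast
  \<comment> \<open>A fixed vector loses no length under \<open>p\<close> or \<open>1 - r\<close>, so it lies in both ranges.\<close>
  have fixed: "v = 0" if "T v = v" for v
  proof -
    have pv: "p v = v" using that T_app orth_projection_idem[OF p] by metis
    have "(norm v)\<^sup>2 = (norm (v - r v))\<^sup>2"
      using form_T[of v] that by (simp add: pv power2_norm_eq_inner)
    then have "r v = 0" using orth_projection_pythagoras[OF r, of v] by simp
    then show ?thesis using disj pv by blast
  qed
  have "(\<lambda>n. x.X n v) \<longlonglongrightarrow> 0" for v
    by (rule x.X_tendsto_0[OF T1 T2 fixed])
  then have "(\<lambda>n. \<tau> (x.X n)) \<longlonglongrightarrow> 0"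
    by (intro normal_functional_tendsto_0[OF tracial_stateD(5)[OF \<tau>] xM x.X_norm_le[OF T3]])
  \<comment> \<open>Even exponents suffice, and for these the power of \<open>S\<close> is the square of a symmetric operator.\<close>
  then have lim: "(\<lambda>n. Re (\<tau> (x.X (n + n)))) \<longlonglongrightarrow> 0"
    using LIMSEQ_subseq_LIMSEQ[of "\<lambda>n. \<tau> (x.X n)" 0 "\<lambda>n. n + n"] tendsto_Re
    by (fastforce simp: strict_mono_def o_def)
  have inter: "x.X n o\<^sub>L (p o\<^sub>L r) = (p o\<^sub>L r) o\<^sub>L y.X n" for n
  proof (induction n)
    case 0 show ?case by (simp add: blinfun_compose_simps(7) rr) (simp add: pp flip: blinfun_compose_simps(7))
  next
    case (Suc n)
    have "T o\<^sub>L (p o\<^sub>L r) = (p o\<^sub>L r) o\<^sub>L S"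
      by (rule blinfun_eqI) (simp add: T_def S_def blinfun.bilinear_simps orth_projection_idem p r)
    then show ?case using Suc by (simp add: blinfun_compose_simps(7)) (simp flip: blinfun_compose_simps(7))
  qed
  have step: "\<tau> (x.X (Suc n)) - \<tau> (y.X (Suc n)) = \<tau> (x.X n) - \<tau> (y.X n)" for n
  proof -
    have "x.X (Suc n) = x.X n - (((p o\<^sub>L r) o\<^sub>L y.X n) o\<^sub>L (r o\<^sub>L p))"
    proof (rule blinfun_eqI)
      fix v
      have "x.X n (p (r (r (p v)))) = p (r (y.X n (r (p v))))"
        using arg_cong[OF inter, of "\<lambda>T. blinfun_apply T (r (p v))"] by simp
      moreover have "x.X n (p v) = x.X n v" using x.X_p by (metis blinfun_apply_blinfun_compose)
      ultimately show "x.X (Suc n) v = (x.X n - (((p o\<^sub>L r) o\<^sub>L y.X n) o\<^sub>L (r o\<^sub>L p))) v"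
        by (simp add: T_def blinfun.bilinear_simps orth_projection_idem[OF r])
    qed
    then have "\<tau> (x.X (Suc n)) = \<tau> (x.X n) - \<tau> (((p o\<^sub>L r) o\<^sub>L y.X n) o\<^sub>L (r o\<^sub>L p))"
      using xM yM pM rM closed by (simp add: diff)
    also have "\<tau> (((p o\<^sub>L r) o\<^sub>L y.X n) o\<^sub>L (r o\<^sub>L p)) = \<tau> ((r o\<^sub>L p) o\<^sub>L ((p o\<^sub>L r) o\<^sub>L y.X n))"
      using yM pM rM closed by (intro trace) auto
    also have "(r o\<^sub>L p) o\<^sub>L ((p o\<^sub>L r) o\<^sub>L y.X n) = (r o\<^sub>L p o\<^sub>L r) o\<^sub>L y.X n"
      by (rule blinfun_eqI) (simp add: orth_projection_idem[OF p])
    also have "\<tau> ((r o\<^sub>L p o\<^sub>L r) o\<^sub>L y.X n) = \<tau> (y.X n o\<^sub>L (r o\<^sub>L p o\<^sub>L r))"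
      using yM pM rM closed by (intro trace) auto
    also have "y.X n o\<^sub>L (r o\<^sub>L p o\<^sub>L r) = y.X n - y.X (Suc n)"
      using y.X_p[of n] by (simp add: S_def blinfun_compose_simps(4))
    finally show ?thesis using yM by (simp only: diff) simp
  qed
  have const: "\<tau> (x.X n) - \<tau> (y.X n) = \<tau> p - \<tau> r" for n
    by (induction n) (simp, simp only: step)
  have "Re (\<tau> p) - Re (\<tau> r) \<le> Re (\<tau> (x.X (n + n)))" for n
  proof -
    have "0 \<le> inner v (y.X (n + n) v)" for v
      using symmetric_opD[OF y.X_symmetric, of n v "y.X n v"] inner_ge_zero[of "y.X n v"]
      by (simp only: y.X_add blinfun_apply_blinfun_compose)
    then have "positive_op (y.X (n + n))"
      using yM M by (intro positive_opI y.X_symmetric) (auto simp: von_neumann_algebra_def)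
    then have "0 \<le> Re (\<tau> (y.X (n + n)))" using tracial_stateD(3)[OF \<tau> yM] by blast
    moreover have "Re (\<tau> (x.X (n + n))) - Re (\<tau> (y.X (n + n))) = Re (\<tau> p) - Re (\<tau> r)"
      using arg_cong[OF const[of "n + n"], of Re] by simp
    ultimately show ?thesis by linarith
  qed
  then have "Re (\<tau> p) - Re (\<tau> r) \<le> 0" by (intro LIMSEQ_le_const[OF lim]) blast
  then show ?thesis by simp
qed

section \<open>Distribution functions\<close>

text \<open>The distribution is a measure built from a set function, and it takes the intended values only
  if that function is countably additive. This follows from normality, applied to the spectral
  projections of the remainders of a disjoint union, which decrease strongly to \<open>0\<close>.\<close>
lemma trace_spectral_measure:
  fixes M :: "('h::chilbert_space \<Rightarrow>\<^sub>L 'h) set"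
  assumes M: "von_neumann_algebra M" and \<tau>: "faithful_normal_tracial_state M \<tau>"
    and c: "c \<in> M" and sym: "symmetric_op c" and E: "E \<in> sets borel"
  shows "measure (op_distribution \<tau> c) E = Re (\<tau> (spectral_projection c E))"
proof -
  have cb: "c \<in> bounded_ops" using M c by (auto simp: von_neumann_algebra_def)
  define P where "P = spectral_projection c"
  interpret spectral_measure P c
    unfolding P_def by (rule spectral_projection_spectral_measure[OF cb sym])
  note PM = P_in_von_neumann[OF M c]
  note add = tracial_stateD(1)[OF \<tau>]
  have tau0: "\<tau> 0 = 0"
    using add[of "P {}" "P {}"] PM[of "{}"] by (simp add: P_empty)
  let ?\<mu> = "\<lambda>E. Re (\<tau> (P E))"
  have nonneg: "0 \<le> ?\<mu> E" if "E \<in> sets borel" for E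
  proof -
    have "positive_op (P E)"
      using proj[OF that] P_bounded[OF that]
      by (intro positive_opI) (auto simp: orth_projection_form orth_projection_def)
    then show ?thesis using tracial_stateD(3)[OF \<tau> PM[OF that]] by blast
  qed
  have disjoint: "\<tau> (P (A \<union> B)) = \<tau> (P A) + \<tau> (P B)"
    if "A \<in> sets borel" "B \<in> sets borel" "A \<inter> B = {}" for A B
    using that by (simp add: P_disjoint_Un add PM)
  have sums: "(\<lambda>n. ?\<mu> (A n)) sums ?\<mu> (\<Union>n. A n)"
    if A: "range A \<subseteq> sets borel" "disjoint_family A" for A :: "nat \<Rightarrow> real set"
  proof -
    define U where "U n = (\<Union>k<n. A k)" for n
    define W where "W = (\<Union>n. A n)"
    have Ab: "A n \<in> sets borel" for n using A by auto
    have Ub: "U n \<in> sets borel" for n unfolding U_def using Ab by (intro sets.finite_UN) auto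
    have Wb: "W \<in> sets borel" unfolding W_def using Ab by (intro sets.countable_UN) auto
    have UA: "U n \<inter> A n = {}" for n
    proof -
      have "A k \<inter> A n = {}" if "k < n" for k
        using disjoint_family_onD[OF A(2), of k n] that by simp
      then show ?thesis by (auto simp: U_def)
    qed
    have USuc: "U (Suc n) = U n \<union> A n" for n by (auto simp: U_def lessThan_Suc)
    have PU: "P (U n) v = (\<Sum>k<n. P (A k) v)" for n v
    proof (induction n)
      case 0 show ?case by (simp add: U_def P_empty blinfun.zero_left)
    next
      case (Suc n) then show ?case
        using P_disjoint_Un[OF Ub Ab UA] by (simp add: USuc blinfun.add_left)
    qed
    have tU: "\<tau> (P (U n)) = (\<Sum>k<n. \<tau> (P (A k)))" for n
    proof (induction n)
      case 0 show ?case by (simp add: U_def P_empty tau0)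
    next
      case (Suc n) then show ?case using disjoint[OF Ub Ab UA] by (simp add: USuc)
    qed
    have split: "U n \<union> (W - U n) = W" "U n \<inter> (W - U n) = {}" for n by (auto simp: U_def W_def)
    have WU: "W - U n \<in> sets borel" for n using Wb Ub by auto
    have tW: "\<tau> (P W) = \<tau> (P (U n)) + \<tau> (P (W - U n))" for n
      using disjoint[OF Ub WU split(2)[of n]] unfolding split(1) .
    have PW: "P (W - U n) v = P W v - P (U n) v" for n v
      using P_disjoint_Un[OF Ub WU split(2)[of n]] unfolding split(1) by (simp add: blinfun.add_left)
    have "(\<lambda>n. P (W - U n) v) \<longlonglongrightarrow> 0" for v
    proof -
      have "(\<lambda>n. P W v - (\<Sum>k<n. P (A k) v)) \<longlonglongrightarrow> P W v - P W v"
        using P_sums[OF A, of v] unfolding sums_def W_def by (intro tendsto_intros)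
      then show ?thesis by (simp add: PW PU)
    qed
    then have "(\<lambda>n. \<tau> (P (W - U n))) \<longlonglongrightarrow> 0"
      by (intro normal_functional_tendsto_0[OF tracial_stateD(5)[OF \<tau>] PM[OF WU] orth_projection_norm_le[OF proj[OF WU]]])
    then have "(\<lambda>n. \<tau> (P W) - \<tau> (P (W - U n))) \<longlonglongrightarrow> \<tau> (P W) - 0" by (intro tendsto_intros)
    moreover have "\<tau> (P W) - \<tau> (P (W - U n)) = (\<Sum>k<n. \<tau> (P (A k)))" for n
      using tW[of n] tU[of n] by simp
    ultimately have "(\<lambda>k. \<tau> (P (A k))) sums \<tau> (P W)" by (simp add: sums_def)
    then show ?thesis unfolding W_def by (rule sums_Re)
  qed
  have "emeasure (op_distribution \<tau> c) E = ennreal (?\<mu> E)"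
    unfolding op_distribution_def P_def[symmetric]
  proof (rule emeasure_measure_of_sigma)
    show "sigma_algebra UNIV (sets borel :: real set set)"
      using sets.sigma_algebra_axioms[of "borel :: real measure"] by simp
    show "positive (sets borel) (\<lambda>E. ennreal (?\<mu> E))" by (simp add: positive_def P_empty tau0)
    show "countably_additive (sets borel) (\<lambda>E. ennreal (?\<mu> E))"
    proof (rule countably_additiveI)
      fix A :: "nat \<Rightarrow> real set"
      assume A: "range A \<subseteq> sets borel" "disjoint_family A"
      show "(\<Sum>n. ennreal (?\<mu> (A n))) = ennreal (?\<mu> (\<Union>n. A n))"
        using A(1) by (intro suminf_ennreal_eq nonneg sums A) auto
    qed
  qed (rule E)
  then show ?thesis using nonneg[OF E] by (simp add: measure_def P_def)
qed

text \<open>The conditions at the two ends ensure that both infima are over nonempty sets bounded from below;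
  otherwise they would be unspecified real numbers.\<close>
lemma quantile_fun_mono:
  assumes le: "\<And>t. dist_fun \<tau> b t \<le> dist_fun \<tau> a t"
    and top: "\<exists>t. s < dist_fun \<tau> b t" and bot: "\<And>t. t \<le> L \<Longrightarrow> dist_fun \<tau> a t \<le> s"
  shows "quantile_fun \<tau> a s \<le> quantile_fun \<tau> b s"
  unfolding quantile_fun_def
proof (rule cInf_superset_mono)
  show "{t. s < dist_fun \<tau> b t} \<noteq> {}" using top by blast
  show "bdd_below {t. s < dist_fun \<tau> a t}"
    using bot by (intro bdd_belowI[of _ L]) (metis linorder_not_le mem_Collect_eq nle_le)
  show "{t. s < dist_fun \<tau> b t} \<subseteq> {t. s < dist_fun \<tau> a t}" using le less_le_trans by blast
qed

lemma dist_fun_eventually: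
  fixes M :: "('h::chilbert_space \<Rightarrow>\<^sub>L 'h) set"
  assumes M: "von_neumann_algebra M" and \<tau>: "faithful_normal_tracial_state M \<tau>"
    and c: "c \<in> M" and sym: "symmetric_op c"
  obtains K where "\<And>t. t \<le> - K \<Longrightarrow> dist_fun \<tau> c t = 0" "\<And>t. K < t \<Longrightarrow> dist_fun \<tau> c t = 1"
proof -
  have cb: "c \<in> bounded_ops" using M c by (auto simp: von_neumann_algebra_def)
  interpret spectral_measure "spectral_projection c" c
    by (rule spectral_projection_spectral_measure[OF cb sym])
  obtain K where K: "spectral_projection c {-K..K} = id_blinfun" using P_compact by blast
  have eq: "spectral_projection c {..<t} = spectral_projection c ({..<t} \<inter> {-K..K})" for t
    using P_Int[of "{..<t}" "{-K..K}"] by (simp add: K blinfun_compose_simps)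
  note \<tau>1 = tracial_stateD(4)[OF \<tau>] and add = tracial_stateD(1)[OF \<tau>]
  have \<tau>0: "\<tau> 0 = 0"
    using add[of "0" "0"] P_in_von_neumann[OF M c, of "{}"] by (simp add: P_empty)
  show thesis
  proof (rule that[of K])
    fix t assume "t \<le> - K"
    then have "{..<t} \<inter> {-K..K} = {}" by auto
    then show "dist_fun \<tau> c t = 0"
      unfolding dist_fun_def trace_spectral_measure[OF M \<tau> c sym, of "{..<t}", simplified] eq
      by (simp add: P_empty \<tau>0)
  next
    fix t assume "K < t"
    then have "{..<t} \<inter> {-K..K} = {-K..K}" by auto
    then show "dist_fun \<tau> c t = 1"
      unfolding dist_fun_def trace_spectral_measure[OF M \<tau> c sym, of "{..<t}", simplified] eq
      by (simp add: K \<tau>1)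
  qed
qed

text \<open>A vector in the range of the projection of \<open>b\<close> for \<open>(-\<infinity>, t)\<close> and in the kernel of that of \<open>a\<close>
  has form at least \<open>t\<close> for \<open>a\<close>, hence for \<open>b\<close>, and must vanish.\<close>
lemma dist_fun_antimono:
  fixes M :: "('h::chilbert_space \<Rightarrow>\<^sub>L 'h) set"
  assumes M: "von_neumann_algebra M" and \<tau>: "faithful_normal_tracial_state M \<tau>"
    and a: "a \<in> M" "symmetric_op a" and b: "b \<in> M" "symmetric_op b"
    and le: "\<And>v. inner v (a v) \<le> inner v (b v)"
  shows "dist_fun \<tau> b t \<le> dist_fun \<tau> a t"
proof -
  have bounded: "a \<in> bounded_ops" "b \<in> bounded_ops"
    using M a b by (auto simp: von_neumann_algebra_def)
  interpret A: spectral_measure "spectral_projection a" a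
    by (rule spectral_projection_spectral_measure[OF bounded(1) a(2)])
  interpret B: spectral_measure "spectral_projection b" b
    by (rule spectral_projection_spectral_measure[OF bounded(2) b(2)])
  have "Re (\<tau> (spectral_projection b {..<t})) \<le> Re (\<tau> (spectral_projection a {..<t}))"
  proof (rule trace_projection_le[OF M \<tau>])
    fix v
    assume vb: "spectral_projection b {..<t} v = v" and va: "spectral_projection a {..<t} v = 0"
    have "spectral_projection a (- {..<t}) v = v" using A.P_Compl[of "{..<t}" v] va by simp
    then have "t * (norm v)\<^sup>2 \<le> A.mean v" by (rule A.mean_lower[rotated]) auto
    then have "t * (norm v)\<^sup>2 \<le> B.mean v" using le[of v] A.form[of v] B.form[of v] by simp
    then show "v = 0" by (rule B.mean_less[OF vb])
  qed (auto intro: A.P_in_von_neumann[OF M a(1)] B.P_in_von_neumann[OF M b(1)] A.proj B.proj)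
  then show ?thesis
    by (simp add: dist_fun_def trace_spectral_measure[OF M \<tau> a] trace_spectral_measure[OF M \<tau> b])
qed

theorem corollary3p6:
  fixes M :: "('h::chilbert_space \<Rightarrow>\<^sub>L 'h) set"
    and \<tau> :: "('h \<Rightarrow>\<^sub>L 'h) \<Rightarrow> complex"
    and a b :: "'h \<Rightarrow>\<^sub>L 'h"
  assumes "II1_factor M" and "separable_predual M"
    and "faithful_normal_tracial_state M \<tau>"
    and "a \<in> M" and "b \<in> M" and "a = adj a" and "b = adj b"
    and "no_atoms (op_distribution \<tau> a)" and "no_atoms (op_distribution \<tau> b)"
  shows "op_le a b \<longrightarrow> (\<forall>s\<in>{0..<1}. quantile_fun \<tau> a s \<le> quantile_fun \<tau> b s)"
proof (intro impI ballI)
  fix s :: real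
  assume le: "op_le a b" and s: "s \<in> {0..<1}"
  have M: "von_neumann_algebra M" using assms(1) by (simp add: II1_factor_def vn_factor_def)
  have sym: "symmetric_op a" "symmetric_op b"
    using M assms(4-7) adj_self_iff unfolding von_neumann_algebra_def by (metis subsetD)+
  have "inner v (a v) \<le> inner v (b v)" for v
    using positive_opD[of "b - a" v] le by (simp add: op_le_def blinfun.bilinear_simps inner_simps)
  then have anti: "dist_fun \<tau> b t \<le> dist_fun \<tau> a t" for t
    by (rule dist_fun_antimono[OF M assms(3,4) sym(1) assms(5) sym(2)])
  obtain K where K: "\<And>t. t \<le> - K \<Longrightarrow> dist_fun \<tau> a t = 0"
    using dist_fun_eventually[OF M assms(3,4) sym(1)] by metis
  obtain L where L: "\<And>t. L < t \<Longrightarrow> dist_fun \<tau> b t = 1"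
    using dist_fun_eventually[OF M assms(3,5) sym(2)] by metis
  show "quantile_fun \<tau> a s \<le> quantile_fun \<tau> b s"
  proof (rule quantile_fun_mono[OF anti])
    show "\<exists>t. s < dist_fun \<tau> b t" using L[of "L + 1"] s by (intro exI[of _ "L + 1"]) simp
    show "dist_fun \<tau> a t \<le> s" if "t \<le> - K" for t using K[OF that] s by simp
  qed
qed

end
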